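(* Let $(M,\omega)$ be an $n$-plectic manifold and let $\mathfrak g$ be a finite-dimensional real Lie algebra acting on $M$ and preserving $\omega$. Let $\widetilde\alpha=\sum_{k=1}^n\widetilde\alpha_k\in\widetilde C$, $\widetilde\alpha_k\in\Lambda^k\mathfrak g^*\otimes\Omega^{n-k}(M)$, be a potential of $\widetilde\omega$ (that is, $\widetilde d_{tot}\widetilde\alpha=\widetilde\omega$) corresponding to a homotopy moment map $\widetilde f$, i.e. $\widetilde f_k=\zeta(k)\widetilde\alpha_k$. Let $\mathcal N$ be the $\mathfrak g$-submodule of $\widetilde d_{tot}$-closed elements of $\widetilde C=\Lambda^{\ge1}\mathfrak g^*\otimes\Omega(M)$. Then $d_{\mathfrak g,\widetilde C}(\widetilde\alpha)$, i.e. the map $\mathfrak g\to\widetilde C$, $x\mapsto x\cdot\widetilde\alpha$, takes values in $\mathcal N$ and yields a well-defined cohomology class $[d_{\mathfrak g,\widetilde C}(\widetilde\alpha)]\in H^1(\mathfrak g,\mathcal N)$. Furthermore, this class vanishes if and only if there exists a $\mathfrak g$-equivariant homotopy moment map for the action.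
   Context: $(M,\omega)$ is $n$-plectic ($n\ge 1$) if $\omega\in\Omega^{n+1}(M)$ is closed and $v\mapsto\iota_v\omega$ is injective as a map $TM\to\Lambda^nT^*M$. An action of $\mathfrak g$ is a Lie algebra homomorphism $\mathfrak g\to\mathfrak X(M)$, $x\mapsto v_x$; it preserves $\omega$ if $\mathcal L_{v_x}\omega=0$ for all $x\in\mathfrak g$. For $p=x_1\wedge\dots\wedge x_k\in\Lambda^k\mathfrak g$ put $v_p=v_{x_1}\wedge\dots\wedge v_{x_k}$ (extended linearly) and $\iota_{v_p}\omega=\iota_{v_{x_k}}\cdots\iota_{v_{x_1}}\omega$. The Lie algebra homology differential $\delta_k:\Lambda^k\mathfrak g\to\Lambda^{k-1}\mathfrak g$ ($k\ge1$) is $$\delta_k(x_1\wedge\dots\wedge x_k)=\sum_{1\le i<j\le k}(-1)^{i+j}[x_i,x_j]\wedge x_1\wedge\dots\widehat{x_i}\dots\widehat{x_j}\dots\wedge x_k.$$ Put $\zeta(k)=-(-1)^{k(k+1)/2}$. A homotopy moment map is a collection of linear maps $\widetilde f_k:\Lambda^k\mathfrak g\to\Omega^{n-k}(M)$, $1\le k\le n$, such that $-\widetilde f_{k-1}(\delta_k p)=d\widetilde f_k(p)+\zeta(k)\iota_{v_p}\omega$ for all $p\in\Lambda^k\mathfrak g$, $1\le k\le n+1$, where $\widetilde f_0=\widetilde f_{n+1}=0$. It is $\mathfrak g$-equivariant if $\widetilde f_k(ad_xp)=\mathcal L_{v_x}\widetilde f_k(p)$ for all $x\in\mathfrak g$,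 $p\in\Lambda^k\mathfrak g$, $1\le k\le n$, where $ad$ is the adjoint action of $\mathfrak g$ on $\Lambda^k\mathfrak g$. $\widetilde C=\Lambda^{\ge1}\mathfrak g^*\otimes\Omega(M)$ is the total complex graded by total degree, with differential $\widetilde d_{tot}=d_{\mathfrak g}\otimes1+1\otimes d$, where $(d_{\mathfrak g}\xi)(p)=\xi(\delta p)$, $d$ is the de Rham differential, and the Koszul sign convention is used ($1\otimes d$ acts on $\Lambda^k\mathfrak g^*\otimes\Omega(M)$ as $(-1)^kd$). Elements of $\Lambda^k\mathfrak g^*\otimes\Omega(M)$ are viewed as linear maps $\Lambda^k\mathfrak g\to\Omega(M)$. Let $\omega_k:\Lambda^k\mathfrak g\to\Omega^{n+1-k}(M)$, $p\mapsto\iota_{v_p}\omega$, and $\widetilde\omega=\sum_{k=1}^{n+1}(-1)^{k-1}\omega_k\in\widetilde C$. It is known that $\widetilde d_{tot}\widetilde\alpha=\widetilde\omega$ if and only if the maps $\zeta(k)\widetilde\alpha_k$ form a homotopy moment map. $\mathfrak g$ acts on $\widetilde C$ by $(x\cdot\eta)(p)=\mathcal L_{v_x}(\eta(p))-\eta(ad_xp)$. For a $\mathfrak g$-module $\mathcal M$, $H^k(\mathfrak g,\mathcal M)$ is the cohomology of $\Lambda\mathfrak g^*\otimes\mathcal M$ with differential $d_{\mathfrak g,\mathcal M}(\alpha)(x_1\wedge\dots\wedge x_{k+1})=\alpha(\delta(x_1\wedge\dots\wedge x_{k+1}))+\sum_{i=1}^{k+1}(-1)^{i+1}x_i\cdot\alpha(x_1\wedge\dots\widehat{x_i}\dots\wedge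 x_{k+1})$; in degree $0$, $d_{\mathfrak g,\mathcal M}(m)(x)=x\cdot m$. *)

theory Defs
  imports "HOL-Analysis.Analysis" "HOL-Library.Function_Algebras" "HOL-Analysis.Finite_Function_Topology"
begin

section \<open>Pointwise vector space structure on functions\<close>

text \<open>Addition and multiplication of functions are those of \<^theory>\<open>HOL-Library.Function_Algebras\<close>.\<close>

instantiation "fun" :: (type, real_vector) real_vector
begin

definition scaleR_fun :: "real \<Rightarrow> ('a \<Rightarrow> 'b) \<Rightarrow> 'a \<Rightarrow> 'b"
  where "scaleR_fun c f = (\<lambda>x. c *\<^sub>R f x)"

instance
  by standard (auto simp: scaleR_fun_def fun_eq_iff scaleR_add_right scaleR_add_left)

end


section \<open>Smooth manifolds\<close>

text \<open>
  The topological space of the manifold is a whole type of class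
  \<open>{t2_space, second_countable_topology}\<close>. The charts take values in \<^term>\<open>Euclidean_space d\<close>,
  so that \<open>d\<close> is an arbitrary natural number (\<open>d = 0\<close> included).
\<close>

definition partial_deriv :: "nat \<Rightarrow> ((nat \<Rightarrow> real) \<Rightarrow> real) \<Rightarrow> (nat \<Rightarrow> real) \<Rightarrow> real"
  where "partial_deriv i f x = deriv (\<lambda>t. f (x(i := t))) (x i)"

text \<open>\<open>C_k d W k f\<close>: all iterated partial derivatives of \<open>f\<close> of order at most \<open>k\<close> exist and are
  continuous on the open subset \<open>W\<close> of \<^term>\<open>Euclidean_space d\<close>.\<close>

primrec C_k :: "nat \<Rightarrow> (nat \<Rightarrow> real) set \<Rightarrow> nat \<Rightarrow> ((nat \<Rightarrow> real) \<Rightarrow> real) \<Rightarrow> bool"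
  where
    "C_k d W 0 f \<longleftrightarrow> continuous_map (subtopology (Euclidean_space d) W) euclideanreal f"
  | "C_k d W (Suc k) f \<longleftrightarrow>
       continuous_map (subtopology (Euclidean_space d) W) euclideanreal f \<and>
       (\<forall>i<d. (\<forall>x\<in>W. (\<lambda>t. f (x(i := t))) differentiable at (x i)) \<and>
              C_k d W k (partial_deriv i f))"

definition C_infinity :: "nat \<Rightarrow> (nat \<Rightarrow> real) set \<Rightarrow> ((nat \<Rightarrow> real) \<Rightarrow> real) \<Rightarrow> bool"
  where "C_infinity d W f \<longleftrightarrow> (\<forall>k. C_k d W k f)"

record 'm manifold =
  mfd_dim :: nat
  charts :: "('m set \<times> ('m \<Rightarrow> nat \<Rightarrow> real)) set"

definition smooth_manifold :: "'m::{t2_space, second_countable_topology} manifold \<Rightarrow> bool"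
  where "smooth_manifold M \<longleftrightarrow>
    (\<Union>(U, \<phi>)\<in>charts M. U) = UNIV \<and>
    (\<forall>(U, \<phi>)\<in>charts M.
       open U \<and> openin (Euclidean_space (mfd_dim M)) (\<phi> ` U) \<and>
       homeomorphic_map (top_of_set U) (subtopology (Euclidean_space (mfd_dim M)) (\<phi> ` U)) \<phi>) \<and>
    (\<forall>(U, \<phi>)\<in>charts M. \<forall>(V, \<psi>)\<in>charts M. \<forall>i<mfd_dim M.
       C_infinity (mfd_dim M) (\<phi> ` (U \<inter> V)) (\<lambda>y. \<psi> (inv_into U \<phi> y) i))"

definition smooth_functions :: "'m manifold \<Rightarrow> ('m \<Rightarrow> real) set"
  where "smooth_functions M =
    {f. \<forall>(U, \<phi>)\<in>charts M. C_infinity (mfd_dim M) (\<phi> ` U) (f \<circ> inv_into U \<phi>)}"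


subsection \<open>Tangent vectors and vector fields\<close>

text \<open>
  Tangent vectors at \<open>p\<close> are the derivations at \<open>p\<close> of the algebra of smooth functions, vector
  fields are the derivations of this algebra. Both are set to 0 on non-smooth functions, so that
  equality is equality of derivations.
\<close>

definition tangent_space :: "'m manifold \<Rightarrow> 'm \<Rightarrow> (('m \<Rightarrow> real) \<Rightarrow> real) set"
  where "tangent_space M p = {v.
    (\<forall>f\<in>smooth_functions M. \<forall>g\<in>smooth_functions M. v (f + g) = v f + v g) \<and>
    (\<forall>f\<in>smooth_functions M. \<forall>c::real. v (c *\<^sub>R f) = c * v f) \<and>
    (\<forall>f\<in>smooth_functions M. \<forall>g\<in>smooth_functions M. v (f * g) = f p * v g + g p * v f) \<and>
    (\<forall>f. f \<notin> smooth_functions M \<longrightarrow> v f = 0)}"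

type_synonym 'm vf = "('m \<Rightarrow> real) \<Rightarrow> 'm \<Rightarrow> real"

definition vector_fields :: "'m manifold \<Rightarrow> 'm vf set"
  where "vector_fields M = {X.
    (\<forall>f\<in>smooth_functions M. X f \<in> smooth_functions M) \<and>
    (\<forall>f\<in>smooth_functions M. \<forall>g\<in>smooth_functions M. X (f + g) = X f + X g) \<and>
    (\<forall>f\<in>smooth_functions M. \<forall>c::real. X (c *\<^sub>R f) = c *\<^sub>R X f) \<and>
    (\<forall>f\<in>smooth_functions M. \<forall>g\<in>smooth_functions M. X (f * g) = f * X g + g * X f) \<and>
    (\<forall>f. f \<notin> smooth_functions M \<longrightarrow> X f = 0)}"

definition vf_at :: "'m vf \<Rightarrow> 'm \<Rightarrow> ('m \<Rightarrow> real) \<Rightarrow> real"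
  where "vf_at X p = (\<lambda>f. X f p)"

definition vf_bracket :: "'m vf \<Rightarrow> 'm vf \<Rightarrow> 'm vf"
  where "vf_bracket X Y = (\<lambda>f. X (Y f) - Y (X f))"


subsection \<open>Differential forms\<close>

text \<open>
  A differential form of degree \<open>k\<close> is an alternating map, multilinear over the ring of smooth
  functions, taking \<open>k\<close> vector fields to a smooth function (as in Helgason, Differential Geometry,
  Lie Groups, and Symmetric Spaces, Ch. I). An element of the full space \<open>\<Omega>(M)\<close> is a single map on
  lists of vector fields of any length; its component of degree \<open>k\<close> is the restriction to lists of
  length \<open>k\<close>. Forms of degree greater than the dimension vanish, so this is the direct sum of the
  spaces \<open>\<Omega>\<^sup>k(M)\<close>. Forms are set to 0 on lists that do not consist of vector fields.
\<close>

type_synonym 'm form = "'m vf list \<Rightarrow> 'm \<Rightarrow> real"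

definition forms :: "'m manifold \<Rightarrow> 'm form set"
  where "forms M = {w.
    (\<forall>Xs. set Xs \<subseteq> vector_fields M \<longrightarrow> w Xs \<in> smooth_functions M) \<and>
    (\<forall>Xs. \<not> set Xs \<subseteq> vector_fields M \<longrightarrow> w Xs = 0) \<and>
    (\<forall>Us Vs. \<forall>X\<in>vector_fields M. \<forall>Y\<in>vector_fields M.
       set Us \<subseteq> vector_fields M \<longrightarrow> set Vs \<subseteq> vector_fields M \<longrightarrow>
       w (Us @ [X + Y] @ Vs) = w (Us @ [X] @ Vs) + w (Us @ [Y] @ Vs)) \<and>
    (\<forall>Us Vs. \<forall>X\<in>vector_fields M. \<forall>f\<in>smooth_functions M.
       set Us \<subseteq> vector_fields M \<longrightarrow> set Vs \<subseteq> vector_fields M \<longrightarrow>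
       w (Us @ [\<lambda>g. f * X g] @ Vs) = f * w (Us @ [X] @ Vs)) \<and>
    (\<forall>Xs. \<not> distinct Xs \<longrightarrow> w Xs = 0)}"

definition forms_deg :: "'m manifold \<Rightarrow> nat \<Rightarrow> 'm form set"
  where "forms_deg M k = {w \<in> forms M. \<forall>Xs. length Xs \<noteq> k \<longrightarrow> w Xs = 0}"

definition contract :: "'m vf \<Rightarrow> 'm form \<Rightarrow> 'm form"
  where "contract X w = (\<lambda>Ys. w (X # Ys))"

text \<open>Note that \<^term>\<open>nths Xs (- {i})\<close> omits the entry with index \<open>i\<close>. Indices start at 0.\<close>

definition ext_deriv :: "'m manifold \<Rightarrow> 'm form \<Rightarrow> 'm form"
  where "ext_deriv M w = (\<lambda>Xs. if set Xs \<subseteq> vector_fields M then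
       (\<Sum>i<length Xs. (-1) ^ i *\<^sub>R (Xs ! i) (w (nths Xs (- {i})))) +
       (\<Sum>j<length Xs. \<Sum>i<j.
          (-1) ^ (i + j) *\<^sub>R w (vf_bracket (Xs ! i) (Xs ! j) # nths Xs (- {i, j})))
     else 0)"

definition lie_deriv :: "'m manifold \<Rightarrow> 'm vf \<Rightarrow> 'm form \<Rightarrow> 'm form"
  where "lie_deriv M X w = (\<lambda>Ys. if set Ys \<subseteq> vector_fields M then
       X (w Ys) - (\<Sum>i<length Ys. w (Ys[i := vf_bracket X (Ys ! i)]))
     else 0)"

text \<open>The value of a form at a point, on tangent vectors: extend the tangent vectors to vector
  fields; by multilinearity over smooth functions the value at \<open>p\<close> does not depend on the choice.\<close>

definition form_at :: "'m manifold \<Rightarrow> 'm form \<Rightarrow> 'm \<Rightarrow> (('m \<Rightarrow> real) \<Rightarrow> real) list \<Rightarrow> real"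
  where "form_at M w p vs = w (map (\<lambda>v. SOME X. X \<in> vector_fields M \<and> vf_at X p = v) vs) p"

definition contract_at ::
    "'m manifold \<Rightarrow> 'm form \<Rightarrow> 'm \<Rightarrow> (('m \<Rightarrow> real) \<Rightarrow> real) \<Rightarrow> (('m \<Rightarrow> real) \<Rightarrow> real) list \<Rightarrow> real"
  where "contract_at M w p v =
    (\<lambda>vs. if set vs \<subseteq> tangent_space M p then form_at M w p (v # vs) else 0)"

definition n_plectic :: "'m manifold \<Rightarrow> nat \<Rightarrow> 'm form \<Rightarrow> bool"
  where "n_plectic M n \<omega> \<longleftrightarrow>
    1 \<le> n \<and> \<omega> \<in> forms_deg M (n + 1) \<and> ext_deriv M \<omega> = 0 \<and>
    inj_on (\<lambda>(p, v). (p, contract_at M \<omega> p v)) (SIGMA p:UNIV. tangent_space M p)"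


section \<open>Exterior algebra\<close>

text \<open>
  The exterior algebra, as a vector space, is the quotient of the free vector space on the lists
  of vectors (the list \<open>[x\<^sub>1,\<dots>,x\<^sub>k]\<close> standing for \<open>x\<^sub>1 \<otimes> \<dots> \<otimes> x\<^sub>k\<close>) by the multilinearity
  relations and the ideal generated by the \<open>x \<otimes> x\<close>.
\<close>

abbreviation gen :: "'g list \<Rightarrow> 'g list \<Rightarrow>\<^sub>0 real"
  where "gen xs \<equiv> Poly_Mapping.single xs 1"

definition ext_relations :: "('g::real_vector list \<Rightarrow>\<^sub>0 real) set"
  where "ext_relations = span (
     {gen (us @ [x + y] @ vs) - gen (us @ [x] @ vs) - gen (us @ [y] @ vs) | us vs x y. True} \<union>
     {gen (us @ [c *\<^sub>R x] @ vs) - c *\<^sub>R gen (us @ [x] @ vs) | us vs c x. True} \<union>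
     {gen (us @ [x, x] @ vs) | us vs x. True})"

lemma subspace_ext_relations: "subspace ext_relations"
  by (simp add: ext_relations_def)

quotient_type (overloaded) 'g ext =
  "'g::real_vector list \<Rightarrow>\<^sub>0 real" / "\<lambda>p q. p - q \<in> ext_relations"
proof (rule equivpI)
  show "reflp (\<lambda>p q. p - q \<in> (ext_relations :: ('g list \<Rightarrow>\<^sub>0 real) set))"
    by (auto simp: reflp_def subspace_0 subspace_ext_relations)
  show "symp (\<lambda>p q. p - q \<in> (ext_relations :: ('g list \<Rightarrow>\<^sub>0 real) set))"
    by (auto simp: symp_def dest: subspace_neg[OF subspace_ext_relations])
  show "transp (\<lambda>p q. p - q \<in> (ext_relations :: ('g list \<Rightarrow>\<^sub>0 real) set))"
    by (auto simp: transp_def dest: subspace_add[OF subspace_ext_relations])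
qed

instantiation ext :: (real_vector) real_vector
begin

lift_definition zero_ext :: "'a ext" is 0 .

lift_definition plus_ext :: "'a ext \<Rightarrow> 'a ext \<Rightarrow> 'a ext" is "(+)"
  by (simp only: add_diff_add subspace_add[OF subspace_ext_relations])

lift_definition minus_ext :: "'a ext \<Rightarrow> 'a ext \<Rightarrow> 'a ext" is "(-)"
proof -
  fix p p' q q' :: "'a list \<Rightarrow>\<^sub>0 real"
  assume "p - p' \<in> ext_relations" "q - q' \<in> ext_relations"
  then have "(p - p') - (q - q') \<in> ext_relations"
    by (rule subspace_diff[OF subspace_ext_relations])
  moreover have "(p - q) - (p' - q') = (p - p') - (q - q')"
    by simp
  ultimately show "(p - q) - (p' - q') \<in> ext_relations"
    by (simp only:)
qed

lift_definition uminus_ext :: "'a ext \<Rightarrow> 'a ext" is uminus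
proof -
  fix p q :: "'a list \<Rightarrow>\<^sub>0 real"
  assume "p - q \<in> ext_relations"
  then have "- (p - q) \<in> ext_relations"
    by (rule subspace_neg[OF subspace_ext_relations])
  then show "- p - - q \<in> ext_relations"
    by simp
qed

lift_definition scaleR_ext :: "real \<Rightarrow> 'a ext \<Rightarrow> 'a ext" is scaleR
  by (simp only: scaleR_diff_right[symmetric] subspace_scale[OF subspace_ext_relations])

instance
proof
  fix a b c :: "'a ext" and r s :: real
  show "a + b + c = a + (b + c)"
    by transfer (simp add: add.assoc subspace_0[OF subspace_ext_relations])
  show "a + b = b + a"
    by transfer (simp add: add.commute subspace_0[OF subspace_ext_relations])
  show "0 + a = a"
    by transfer (simp add: subspace_0[OF subspace_ext_relations])
  show "- a + a = 0"
    by transfer (simp add: subspace_0[OF subspace_ext_relations])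
  show "a - b = a + - b"
    by transfer (simp add: subspace_0[OF subspace_ext_relations])
  show "r *\<^sub>R (a + b) = r *\<^sub>R a + r *\<^sub>R b"
    by transfer (simp add: scaleR_add_right subspace_0[OF subspace_ext_relations])
  show "(r + s) *\<^sub>R a = r *\<^sub>R a + s *\<^sub>R a"
    by transfer (simp add: scaleR_add_left subspace_0[OF subspace_ext_relations])
  show "r *\<^sub>R s *\<^sub>R a = (r * s) *\<^sub>R a"
    by transfer (simp add: subspace_0[OF subspace_ext_relations])
  show "1 *\<^sub>R a = a"
    by transfer (simp add: subspace_0[OF subspace_ext_relations])
qed

end

lift_definition wedge :: "'g::real_vector list \<Rightarrow> 'g ext" is gen .

definition ext_power :: "nat \<Rightarrow> 'g::real_vector ext set"
  where "ext_power k = span {wedge xs | xs. length xs = k}"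

text \<open>The linear extension of a rule for \<open>x\<^sub>1 \<and> \<dots> \<and> x\<^sub>k\<close>, for \<open>F\<close> alternating multilinear.\<close>

definition lin_ext :: "('g::real_vector list \<Rightarrow> 'w::real_vector) \<Rightarrow> 'g ext \<Rightarrow> 'w"
  where "lin_ext F = (THE L. linear L \<and> (\<forall>xs. L (wedge xs) = F xs))"


section \<open>Lie algebras, their actions and cohomology\<close>

definition lie_algebra :: "('g::real_vector \<Rightarrow> 'g \<Rightarrow> 'g) \<Rightarrow> bool"
  where "lie_algebra br \<longleftrightarrow>
    bilinear br \<and> (\<forall>x. br x x = 0) \<and>
    (\<forall>x y z. br x (br y z) + br y (br z x) + br z (br x y) = 0)"

definition delta :: "('g::real_vector \<Rightarrow> 'g \<Rightarrow> 'g) \<Rightarrow> 'g ext \<Rightarrow> 'g ext"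
  where "delta br = lin_ext (\<lambda>xs. \<Sum>j<length xs. \<Sum>i<j.
    (-1) ^ (i + j) *\<^sub>R wedge (br (xs ! i) (xs ! j) # nths xs (- {i, j})))"

definition ad_ext :: "('g::real_vector \<Rightarrow> 'g \<Rightarrow> 'g) \<Rightarrow> 'g \<Rightarrow> 'g ext \<Rightarrow> 'g ext"
  where "ad_ext br x = lin_ext (\<lambda>xs. \<Sum>i<length xs. wedge (xs[i := br x (xs ! i)]))"

definition lie_action ::
    "'m manifold \<Rightarrow> ('g::real_vector \<Rightarrow> 'g \<Rightarrow> 'g) \<Rightarrow> ('g \<Rightarrow> 'm vf) \<Rightarrow> bool"
  where "lie_action M br v \<longleftrightarrow>
    linear v \<and> range v \<subseteq> vector_fields M \<and> (\<forall>x y. v (br x y) = vf_bracket (v x) (v y))"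

text \<open>A module is given as a subspace \<open>W\<close> of a real vector space, with action \<open>act\<close>.\<close>

definition lie_module ::
    "('g::real_vector \<Rightarrow> 'g \<Rightarrow> 'g) \<Rightarrow> ('g \<Rightarrow> 'w::real_vector \<Rightarrow> 'w) \<Rightarrow> 'w set \<Rightarrow> bool"
  where "lie_module br act W \<longleftrightarrow>
    subspace W \<and>
    (\<forall>x. \<forall>w\<in>W. act x w \<in> W) \<and>
    (\<forall>x. \<forall>w\<in>W. \<forall>w'\<in>W. act x (w + w') = act x w + act x w') \<and>
    (\<forall>x c. \<forall>w\<in>W. act x (c *\<^sub>R w) = c *\<^sub>R act x w) \<and>
    (\<forall>w\<in>W. linear (\<lambda>x. act x w)) \<and>
    (\<forall>x y. \<forall>w\<in>W. act (br x y) w = act x (act y w) - act y (act x w))"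

text \<open>Elements of \<open>\<Lambda>\<^sup>k\<gg>\<^sup>* \<otimes> W\<close>, as linear maps on the exterior algebra that vanish on the
  other exterior powers.\<close>

definition CE_cochains :: "'w::real_vector set \<Rightarrow> nat \<Rightarrow> ('g::real_vector ext \<Rightarrow> 'w) set"
  where "CE_cochains W k =
    {c. linear c \<and> c ` ext_power k \<subseteq> W \<and> (\<forall>j. j \<noteq> k \<longrightarrow> (\<forall>p\<in>ext_power j. c p = 0))}"

definition CE_diff ::
    "('g::real_vector \<Rightarrow> 'g \<Rightarrow> 'g) \<Rightarrow> ('g \<Rightarrow> 'w::real_vector \<Rightarrow> 'w) \<Rightarrow> ('g ext \<Rightarrow> 'w) \<Rightarrow> 'g ext \<Rightarrow> 'w"
  where "CE_diff br act c = lin_ext (\<lambda>xs. c (delta br (wedge xs)) +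
    (\<Sum>i<length xs. (-1) ^ i *\<^sub>R act (xs ! i) (c (wedge (nths xs (- {i}))))))"

text \<open>The degree 0 cochain given by an element of the module.\<close>

definition CE_const :: "'w::real_vector \<Rightarrow> 'g::real_vector ext \<Rightarrow> 'w"
  where "CE_const w = lin_ext (\<lambda>xs. if xs = [] then w else 0)"

definition CE_cocycles ::
    "('g::real_vector \<Rightarrow> 'g \<Rightarrow> 'g) \<Rightarrow> ('g \<Rightarrow> 'w::real_vector \<Rightarrow> 'w) \<Rightarrow> 'w set \<Rightarrow> nat \<Rightarrow> ('g ext \<Rightarrow> 'w) set"
  where "CE_cocycles br act W k = {c \<in> CE_cochains W k. CE_diff br act c = 0}"

definition CE_coboundaries ::
    "('g::real_vector \<Rightarrow> 'g \<Rightarrow> 'g) \<Rightarrow> ('g \<Rightarrow> 'w::real_vector \<Rightarrow> 'w) \<Rightarrow> 'w set \<Rightarrow> nat \<Rightarrow> ('g ext \<Rightarrow> 'w) set"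
  where "CE_coboundaries br act W k =
    (case k of 0 \<Rightarrow> {0} | Suc j \<Rightarrow> CE_diff br act ` CE_cochains W j)"

definition cohomologous ::
    "('g::real_vector \<Rightarrow> 'g \<Rightarrow> 'g) \<Rightarrow> ('g \<Rightarrow> 'w::real_vector \<Rightarrow> 'w) \<Rightarrow> 'w set \<Rightarrow> nat
      \<Rightarrow> (('g ext \<Rightarrow> 'w) \<times> ('g ext \<Rightarrow> 'w)) set"
  where "cohomologous br act W k = {(a, b). a \<in> CE_cocycles br act W k \<and>
    b \<in> CE_cocycles br act W k \<and> a - b \<in> CE_coboundaries br act W k}"

definition CE_cohomology ::
    "('g::real_vector \<Rightarrow> 'g \<Rightarrow> 'g) \<Rightarrow> ('g \<Rightarrow> 'w::real_vector \<Rightarrow> 'w) \<Rightarrow> 'w set \<Rightarrow> nat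
      \<Rightarrow> ('g ext \<Rightarrow> 'w) set set"
  where "CE_cohomology br act W k = CE_cocycles br act W k // cohomologous br act W k"

definition CE_class ::
    "('g::real_vector \<Rightarrow> 'g \<Rightarrow> 'g) \<Rightarrow> ('g \<Rightarrow> 'w::real_vector \<Rightarrow> 'w) \<Rightarrow> 'w set \<Rightarrow> nat
      \<Rightarrow> ('g ext \<Rightarrow> 'w) \<Rightarrow> ('g ext \<Rightarrow> 'w) set"
  where "CE_class br act W k c = cohomologous br act W k `` {c}"


section \<open>Homotopy moment maps\<close>

definition preserves_form :: "'m manifold \<Rightarrow> ('g \<Rightarrow> 'm vf) \<Rightarrow> 'm form \<Rightarrow> bool"
  where "preserves_form M v \<omega> \<longleftrightarrow> (\<forall>x. lie_deriv M (v x) \<omega> = 0)"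

text \<open>\<open>p \<mapsto> \<iota>(v\<^sub>p) \<omega>\<close>; the fold is \<open>\<iota>(v x\<^sub>k) \<dots> \<iota>(v x\<^sub>1) \<omega>\<close>.\<close>

definition contract_ext :: "('g::real_vector \<Rightarrow> 'm vf) \<Rightarrow> 'm form \<Rightarrow> 'g ext \<Rightarrow> 'm form"
  where "contract_ext v \<omega> = lin_ext (\<lambda>xs. fold (\<lambda>x. contract (v x)) xs \<omega>)"

definition zeta :: "nat \<Rightarrow> real"
  where "zeta k = - ((-1) ^ (k * (k + 1) div 2))"

text \<open>Only the restrictions of \<open>f k\<close> to \<^term>\<open>ext_power k\<close>, for \<open>1 \<le> k \<le> n\<close>, matter.\<close>

definition homotopy_moment_map ::
    "'m manifold \<Rightarrow> nat \<Rightarrow> 'm form \<Rightarrow> ('g::real_vector \<Rightarrow> 'g \<Rightarrow> 'g) \<Rightarrow> ('g \<Rightarrow> 'm vf)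
      \<Rightarrow> (nat \<Rightarrow> 'g ext \<Rightarrow> 'm form) \<Rightarrow> bool"
  where "homotopy_moment_map M n \<omega> br v f \<longleftrightarrow>
    (\<forall>k\<in>{1..n}. f k ` ext_power k \<subseteq> forms_deg M (n - k) \<and>
       (\<forall>p\<in>ext_power k. \<forall>q\<in>ext_power k. f k (p + q) = f k p + f k q) \<and>
       (\<forall>p\<in>ext_power k. \<forall>c. f k (c *\<^sub>R p) = c *\<^sub>R f k p)) \<and>
    (let f' = (\<lambda>k. if k \<in> {1..n} then f k else 0) in
     \<forall>k\<in>{1..n + 1}. \<forall>p\<in>ext_power k.
       - f' (k - 1) (delta br p) = ext_deriv M (f' k p) + zeta k *\<^sub>R contract_ext v \<omega> p)"

definition equivariant_moment_map ::
    "'m manifold \<Rightarrow> nat \<Rightarrow> ('g::real_vector \<Rightarrow> 'g \<Rightarrow> 'g) \<Rightarrow> ('g \<Rightarrow> 'm vf)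
      \<Rightarrow> (nat \<Rightarrow> 'g ext \<Rightarrow> 'm form) \<Rightarrow> bool"
  where "equivariant_moment_map M n br v f \<longleftrightarrow>
    (\<forall>x. \<forall>k\<in>{1..n}. \<forall>p\<in>ext_power k. f k (ad_ext br x p) = lie_deriv M (v x) (f k p))"

text \<open>
  For finite-dimensional \<open>\<gg>\<close>, the space \<open>\<Lambda>\<^sup>\<ge>\<^sup>1\<gg>\<^sup>* \<otimes> \<Omega>(M)\<close> consists of the linear maps from the
  exterior algebra to \<open>\<Omega>(M)\<close> that vanish on \<open>\<Lambda>\<^sup>0\<gg>\<close>. The component \<open>\<eta>\<^sub>k\<close> of \<open>\<eta>\<close> is its restriction
  to \<^term>\<open>ext_power k\<close>.
\<close>

definition C_tilde :: "'m manifold \<Rightarrow> ('g::real_vector ext \<Rightarrow> 'm form) set"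
  where "C_tilde M = {\<eta>. linear \<eta> \<and> range \<eta> \<subseteq> forms M \<and> (\<forall>p\<in>ext_power 0. \<eta> p = 0)}"

definition C_tilde_deg :: "'m manifold \<Rightarrow> nat \<Rightarrow> ('g::real_vector ext \<Rightarrow> 'm form) set"
  where "C_tilde_deg M m = {\<eta> \<in> C_tilde M.
    (\<forall>k\<in>{1..m}. \<eta> ` ext_power k \<subseteq> forms_deg M (m - k)) \<and>
    (\<forall>k>m. \<forall>p\<in>ext_power k. \<eta> p = 0)}"

definition d_tot ::
    "'m manifold \<Rightarrow> ('g::real_vector \<Rightarrow> 'g \<Rightarrow> 'g) \<Rightarrow> ('g ext \<Rightarrow> 'm form) \<Rightarrow> 'g ext \<Rightarrow> 'm form"
  where "d_tot M br \<eta> = lin_ext (\<lambda>xs.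
    \<eta> (delta br (wedge xs)) + (-1) ^ length xs *\<^sub>R ext_deriv M (\<eta> (wedge xs)))"

definition omega_tilde ::
    "nat \<Rightarrow> 'm form \<Rightarrow> ('g::real_vector \<Rightarrow> 'm vf) \<Rightarrow> 'g ext \<Rightarrow> 'm form"
  where "omega_tilde n \<omega> v = lin_ext (\<lambda>xs. if length xs \<in> {1..n + 1}
    then (-1) ^ (length xs - 1) *\<^sub>R contract_ext v \<omega> (wedge xs) else 0)"

definition C_act ::
    "'m manifold \<Rightarrow> ('g::real_vector \<Rightarrow> 'g \<Rightarrow> 'g) \<Rightarrow> ('g \<Rightarrow> 'm vf) \<Rightarrow> 'g
      \<Rightarrow> ('g ext \<Rightarrow> 'm form) \<Rightarrow> 'g ext \<Rightarrow> 'm form"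
  where "C_act M br v x \<eta> = (\<lambda>p. lie_deriv M (v x) (\<eta> p) - \<eta> (ad_ext br x p))"

definition closed_elements ::
    "'m manifold \<Rightarrow> ('g::real_vector \<Rightarrow> 'g \<Rightarrow> 'g) \<Rightarrow> ('g ext \<Rightarrow> 'm form) set"
  where "closed_elements M br = {\<eta> \<in> C_tilde M. d_tot M br \<eta> = 0}"

end

theory Submission
  imports Defs
begin

text \<open>
  Since \<open>d_tot\<close> commutes with the action, and \<open>\<omega>\<close>, hence \<open>\<omega>_tilde\<close>, is invariant, every
  \<open>x \<cdot> \<alpha>\<close> is closed. The class of \<open>x \<mapsto> x \<cdot> \<alpha>\<close> vanishes iff \<open>x \<cdot> \<alpha> = x \<cdot> \<beta>\<close> for some closed
  \<open>\<beta>\<close>, that is, iff \<open>\<alpha>\<close> can be changed by a closed element to an invariant potential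
  \<open>\<alpha> - \<beta>\<close>; and invariant potentials of total degree \<open>n\<close> are equivariant moment maps, up to the signs
  \<open>\<zeta>(k)\<close>. The commutation relations follow by induction on argument lists from the recursions
  \<open>\<delta>(x \<and> p) = - ad\<^sub>x p - x \<and> \<delta> p\<close> and \<open>\<iota>\<^sub>X d = L\<^sub>X - d \<iota>\<^sub>X\<close>.
\<close>

section \<open>Linear maps on the exterior algebra\<close>

text \<open>The maps \<open>delta\<close>, \<open>ad_ext\<close>, \<open>contract_ext\<close>,
  \<open>d_tot\<close>, \<open>omega_tilde\<close> and \<open>CE_diff\<close> are all defined
  through \<open>lin_ext\<close>, a definite description that says nothing until a linear map with
  the prescribed values on wedges is known to exist. So each formula is first shown to be
  alternating multilinear, or linear on each exterior power, or equal to a simpler one; only then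
  can it be evaluated. On the side of forms, analysis enters only to show that smooth functions are
  closed under sums and products. The rest is algebra, and the same formalism appears twice: wedging
  with x in the exterior algebra mirrors contraction with X on forms. ad and L are derivations with
  respect to these operations, \<delta> and d satisfy a Cartan formula with them, and the inductions
  are parallel. The passage between potentials and moment maps rests on
  \<open>\<zeta>(k) = (-1)^k \<zeta>(k-1)\<close>, which absorbs the Koszul sign of
  \<open>d_tot\<close>, and on \<open>\<zeta>(k)^2 = 1\<close>.\<close>

definition alternating_multilinear :: "('g::real_vector list \<Rightarrow> 'w::real_vector) \<Rightarrow> bool"
  where "alternating_multilinear F \<longleftrightarrow>
    (\<forall>us vs x y. F (us @ [x + y] @ vs) = F (us @ [x] @ vs) + F (us @ [y] @ vs)) \<and>
    (\<forall>us vs c x. F (us @ [c *\<^sub>R x] @ vs) = c *\<^sub>R F (us @ [x] @ vs)) \<and>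
    (\<forall>us vs x. F (us @ [x, x] @ vs) = 0)"

lemma alternating_multilinearI:
  assumes "\<And>us vs x y. F (us @ [x + y] @ vs) = F (us @ [x] @ vs) + F (us @ [y] @ vs)"
    and "\<And>us vs c x. F (us @ [c *\<^sub>R x] @ vs) = c *\<^sub>R F (us @ [x] @ vs)"
    and "\<And>us vs x. F (us @ [x, x] @ vs) = 0"
  shows "alternating_multilinear F"
  using assms by (auto simp: alternating_multilinear_def)

lemma alternating_multilinearD:
  assumes "alternating_multilinear F"
  shows "F (us @ (x + y) # vs) = F (us @ x # vs) + F (us @ y # vs)"
    and "F (us @ (c *\<^sub>R x) # vs) = c *\<^sub>R F (us @ x # vs)"
    and "F (us @ x # x # vs) = 0"
  using assms by (auto simp: alternating_multilinear_def)

section \<open>Linear extension over the free vector space and its quotient\<close>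

lemma lookup_scaleR_poly_mapping: "Poly_Mapping.lookup (c *\<^sub>R p) k = c *\<^sub>R Poly_Mapping.lookup p k"
proof -
  have "finite {i. c *\<^sub>R Poly_Mapping.lookup p i \<noteq> 0}"
    by (rule finite_subset[OF _ finite_lookup[of p]]) auto
  then show ?thesis
    by (simp add: scaleR_poly_mapping_def Abs_poly_mapping_inverse)
qed

definition free_ext :: "('a \<Rightarrow> 'w::real_vector) \<Rightarrow> ('a \<Rightarrow>\<^sub>0 real) \<Rightarrow> 'w"
  where "free_ext F p = (\<Sum>k\<in>Poly_Mapping.keys p. Poly_Mapping.lookup p k *\<^sub>R F k)"

lemma free_ext_superset:
  assumes "finite S" "Poly_Mapping.keys p \<subseteq> S"
  shows "free_ext F p = (\<Sum>k\<in>S. Poly_Mapping.lookup p k *\<^sub>R F k)"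
  unfolding free_ext_def by (rule sum.mono_neutral_left) (use assms in \<open>auto simp: in_keys_iff\<close>)

lemma linear_free_ext: "linear (free_ext F)"
proof (rule linearI)
  fix p q :: "'a \<Rightarrow>\<^sub>0 real" and c :: real
  let ?S = "Poly_Mapping.keys p \<union> Poly_Mapping.keys q"
  have "free_ext F (p + q) = (\<Sum>k\<in>?S. Poly_Mapping.lookup (p + q) k *\<^sub>R F k)"
    by (rule free_ext_superset) (use Poly_Mapping.keys_add[of p q] in auto)
  moreover have "free_ext F p = (\<Sum>k\<in>?S. Poly_Mapping.lookup p k *\<^sub>R F k)"
    by (rule free_ext_superset) auto
  moreover have "free_ext F q = (\<Sum>k\<in>?S. Poly_Mapping.lookup q k *\<^sub>R F k)"
    by (rule free_ext_superset) auto
  ultimately show "free_ext F (p + q) = free_ext F p + free_ext F q"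
    by (simp add: Poly_Mapping.lookup_add scaleR_add_left sum.distrib)
  have "free_ext F (c *\<^sub>R p) = (\<Sum>k\<in>Poly_Mapping.keys p. Poly_Mapping.lookup (c *\<^sub>R p) k *\<^sub>R F k)"
    by (rule free_ext_superset) (auto simp: in_keys_iff lookup_scaleR_poly_mapping)
  then show "free_ext F (c *\<^sub>R p) = c *\<^sub>R free_ext F p"
    by (simp add: free_ext_def scaleR_sum_right lookup_scaleR_poly_mapping)
qed

lemma free_ext_gen [simp]: "free_ext F (gen xs) = F xs"
  by (simp add: free_ext_def)

lemma free_poly_mapping_in_span: "(p :: 'a \<Rightarrow>\<^sub>0 real) \<in> span (range (\<lambda>k. Poly_Mapping.single k 1))"
proof -
  have "p = free_ext (\<lambda>k. Poly_Mapping.single k 1) p"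
    by (rule poly_mapping_eqI)
      (auto simp: free_ext_def lookup_sum lookup_scaleR_poly_mapping lookup_single when_def in_keys_iff if_distrib
        sum.delta cong: if_cong)
  also have "\<dots> \<in> span (range (\<lambda>k. Poly_Mapping.single k 1))"
    unfolding free_ext_def by (intro span_sum span_scale span_base) auto
  finally show ?thesis .
qed

text \<open>The three families that generate the relations are exactly the three clauses of
  \<open>alternating_multilinear\<close>, and a linear map that vanishes on generators vanishes on
  their span.\<close>

lemma free_ext_relations:
  assumes "alternating_multilinear F" "p \<in> ext_relations"
  shows "free_ext F p = 0"
proof (rule linear_eq_0_on_span[OF linear_free_ext _ assms(2)[unfolded ext_relations_def]])
  note lin = linear_add[OF linear_free_ext] linear_diff[OF linear_free_ext]
    linear_scale[OF linear_free_ext]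
  note F = assms(1)[unfolded alternating_multilinear_def]
  fix p :: "'a list \<Rightarrow>\<^sub>0 real"
  assume "p \<in> {gen (us @ [x + y] @ vs) - gen (us @ [x] @ vs) - gen (us @ [y] @ vs) | us vs x y. True} \<union>
     {gen (us @ [c *\<^sub>R x] @ vs) - c *\<^sub>R gen (us @ [x] @ vs) | us vs c x. True} \<union>
     {gen (us @ [x, x] @ vs) | us vs x. True}"
  then show "free_ext F p = 0"
    using F by (elim UnE CollectE exE conjE) (simp_all only: lin free_ext_gen, simp_all)
qed

lemma linear_abs_ext: "linear abs_ext"
  by (rule linearI) (simp_all add: plus_ext.abs_eq scaleR_ext.abs_eq)

lemma abs_ext_gen: "abs_ext (gen xs) = wedge xs"
  by (simp add: wedge.abs_eq)

lemma abs_ext_surj: "\<exists>q. p = abs_ext q"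
  by (metis Quotient_abs_rep[OF Quotient_ext])

text \<open>The quotient map is linear and onto, so it carries a spanning set to a spanning set.
  From here on, linear maps on the exterior algebra are compared on wedges only.\<close>

lemma ext_in_span_wedge: "(p :: 'g::real_vector ext) \<in> span (range wedge)"
proof -
  obtain q where "p = abs_ext q"
    using abs_ext_surj by blast
  have "abs_ext q \<in> span (abs_ext ` range gen)"
    using free_poly_mapping_in_span[of q]
    by (subst linear_span_image[OF linear_abs_ext]) blast
  then show ?thesis
    using \<open>p = abs_ext q\<close> by (simp add: image_image abs_ext_gen)
qed

lemma linear_eq_on_wedge:
  assumes "linear f" "linear g" "\<And>xs. f (wedge xs) = g (wedge xs)"
  shows "f p = g p"
  by (rule linear_eq_on_span[OF assms(1,2) _ ext_in_span_wedge[of p]]) (use assms(3) in auto)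

lemma ext_power_induct [consumes 1, case_names wedge zero add scale]:
  assumes "p \<in> ext_power k" "\<And>xs. length xs = k \<Longrightarrow> P (wedge xs)" "P 0"
    "\<And>p q. p \<in> ext_power k \<Longrightarrow> q \<in> ext_power k \<Longrightarrow> P p \<Longrightarrow> P q \<Longrightarrow> P (p + q)"
    "\<And>c p. p \<in> ext_power k \<Longrightarrow> P p \<Longrightarrow> P (c *\<^sub>R p)"
  shows "P p"
proof -
  have "p \<in> ext_power k \<and> P p"
    using assms(1)[unfolded ext_power_def]
  proof (induction rule: span_induct_alt)
    case base
    then show ?case using assms(3) by (simp add: ext_power_def span_zero)
  next
    case (step c x y)
    then obtain xs where xs: "x = wedge xs" "length xs = k" by blast
    then have "x \<in> ext_power k" unfolding ext_power_def by (blast intro: span_base)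
    then show ?case using step assms(2)[OF xs(2)] assms(4,5) xs(1)
      by (simp add: ext_power_def span_add span_scale)
  qed
  then show ?thesis ..
qed

text \<open>The universal property of the exterior algebra; it is what gives the definite
  description in \<open>lin_ext\<close> a meaning.\<close>

lemma lin_ext_exists:
  assumes "alternating_multilinear F"
  shows "\<exists>!L. linear L \<and> (\<forall>xs. L (wedge xs) = F xs)"
proof (rule ex_ex1I)
  have well_defined: "free_ext F p = free_ext F q" if "p - q \<in> ext_relations" for p q
    using free_ext_relations[OF assms that] by (simp add: linear_diff[OF linear_free_ext])
  \<comment> \<open>The value is taken at an arbitrary representative; \<open>well_defined\<close>
    makes the choice irrelevant, and L inherits linearity.\<close>
  define L where "L p = free_ext F (rep_ext p)" for p
  have L: "L (abs_ext q) = free_ext F q" for q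
    unfolding L_def
    by (rule well_defined) (metis ext.abs_eq_iff Quotient_abs_rep[OF Quotient_ext])
  have "L (p + q) = L p + L q" "L (c *\<^sub>R p) = c *\<^sub>R L p" for p q c
    using abs_ext_surj[of p] abs_ext_surj[of q]
    by (auto simp: L plus_ext.abs_eq scaleR_ext.abs_eq linear_add[OF linear_free_ext]
        linear_scale[OF linear_free_ext])
  moreover have "L (wedge xs) = F xs" for xs
    by (metis L abs_ext_gen free_ext_gen)
  ultimately show "\<exists>L. linear L \<and> (\<forall>xs. L (wedge xs) = F xs)"
    by (intro exI[of _ L]) (auto intro: linearI)
next
  fix L L' assume *: "linear L \<and> (\<forall>xs. L (wedge xs) = F xs)" "linear L' \<and> (\<forall>xs. L' (wedge xs) = F xs)"
  show "L = L'"
    by (rule HOL.ext, rule linear_eq_on_wedge) (use * in auto)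
qed

lemma lin_ext:
  assumes "alternating_multilinear F"
  shows linear_lin_ext: "linear (lin_ext F)" and lin_ext_wedge: "lin_ext F (wedge xs) = F xs"
  using theI'[OF lin_ext_exists[OF assms]] by (auto simp: lin_ext_def)

text \<open>An explicit linear witness takes the place of a check that F is alternating multilinear;
  uniqueness holds because wedges span.\<close>

lemma lin_ext_eqI:
  assumes "linear L" "\<And>xs. L (wedge xs) = F xs"
  shows "lin_ext F = L"
  unfolding lin_ext_def
  by (rule the_equality) (auto simp: assms intro!: HOL.ext intro: linear_eq_on_wedge[OF _ assms(1)])

lemma wedge_alternating_multilinear: "alternating_multilinear wedge"
proof -
  have eq: "wedge xs = wedge ys + c *\<^sub>R wedge zs"
    if "gen xs - (gen ys + c *\<^sub>R gen zs) \<in> ext_relations" for c and xs ys zs :: "'a list"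
    using that
    by (simp add: ext.abs_eq_iff[symmetric] linear_add[OF linear_abs_ext]
        linear_scale[OF linear_abs_ext] abs_ext_gen)
  have *: "wedge xs = 0" if "gen xs \<in> ext_relations" for xs :: "'a list"
    using that by transfer simp
  show ?thesis
  proof (rule alternating_multilinearI)
    fix us vs and x y :: 'a and c :: real
    have "gen (us @ [x + y] @ vs) - gen (us @ [x] @ vs) - gen (us @ [y] @ vs) \<in> ext_relations"
      unfolding ext_relations_def by (rule span_base) blast
    then show "wedge (us @ [x + y] @ vs) = wedge (us @ [x] @ vs) + wedge (us @ [y] @ vs)"
      using eq[of "us @ [x + y] @ vs" "us @ [x] @ vs" 1 "us @ [y] @ vs"]
      by (simp only: scaleR_one diff_diff_eq)
    have "gen (us @ [c *\<^sub>R x] @ vs) - c *\<^sub>R gen (us @ [x] @ vs) \<in> ext_relations"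
      unfolding ext_relations_def by (rule span_base) blast
    then show "wedge (us @ [c *\<^sub>R x] @ vs) = c *\<^sub>R wedge (us @ [x] @ vs)"
      by (simp add: ext.abs_eq_iff[symmetric] linear_scale[OF linear_abs_ext] abs_ext_gen)
    show "wedge (us @ [x, x] @ vs) = 0"
      by (rule *, unfold ext_relations_def, rule span_base) blast
  qed
qed

lemma alternating_multilinear_Cons:
  assumes "alternating_multilinear F"
  shows "alternating_multilinear (\<lambda>xs. F (x # xs))"
  using alternating_multilinearD[OF assms, of "x # us" for us]
  by (intro alternating_multilinearI) simp_all

text \<open>Made for formulas that change with the degree, such as the Koszul sign. Alternation
  comes from homogeneity: taking the scalar 0 shows that G sends 0 to 0, and wedges with a repeated
  neighbour are already 0.\<close>

lemma alternating_multilinear_of_linear: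
  assumes "\<And>k p q. p \<in> ext_power k \<Longrightarrow> q \<in> ext_power k \<Longrightarrow> G k (p + q) = G k p + G k q"
    and "\<And>k p c. p \<in> ext_power k \<Longrightarrow> G k (c *\<^sub>R p) = c *\<^sub>R G k p"
  shows "alternating_multilinear (\<lambda>xs. G (length xs) (wedge xs))"
proof (rule alternating_multilinearI)
  have mem: "wedge xs \<in> ext_power (length xs)" for xs :: "'a list"
    unfolding ext_power_def by (rule span_base) blast
  have mem': "wedge ys \<in> ext_power (length xs)" if "length xs = length ys" for xs ys :: "'a list"
    using mem[of ys] that by simp
  note w = alternating_multilinearD[OF wedge_alternating_multilinear]
  fix us vs and x y :: 'a and c :: real
  show "G (length (us @ [x + y] @ vs)) (wedge (us @ [x + y] @ vs)) =
      G (length (us @ [x] @ vs)) (wedge (us @ [x] @ vs)) + G (length (us @ [y] @ vs)) (wedge (us @ [y] @ vs))"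
    using assms(1)[OF mem[of "us @ x # vs"] mem'[of _ "us @ y # vs"]] by (simp add: w)
  show "G (length (us @ [c *\<^sub>R x] @ vs)) (wedge (us @ [c *\<^sub>R x] @ vs)) =
      c *\<^sub>R G (length (us @ [x] @ vs)) (wedge (us @ [x] @ vs))"
    using assms(2)[OF mem[of "us @ x # vs"], of c] by (simp add: w)
  show "G (length (us @ [x, x] @ vs)) (wedge (us @ [x, x] @ vs)) = 0"
    using assms(2)[OF mem[of "us @ x # x # vs"], of 0] by (simp add: w)
qed

text \<open>Polarization: expand F with the entry x + y repeated in two adjacent places.\<close>

lemma alternating_multilinear_swap:
  assumes "alternating_multilinear F"
  shows "F (us @ x # y # vs) = - F (us @ y # x # vs)"
proof -
  note F = alternating_multilinearD[OF assms]
  have "0 = F (us @ (x + y) # (x + y) # vs)"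
    by (simp add: F)
  also have "\<dots> = F (us @ x # y # vs) + F (us @ y # x # vs)"
    using F(1)[of "us @ [x]" x y vs] F(1)[of "us @ [y]" x y vs]
      F(1)[of us x y "(x + y) # vs"] F(3)[of us] by simp
  finally show ?thesis
    by (simp add: eq_neg_iff_add_eq_0)
qed

section \<open>The adjoint action and the differential of Lie algebra homology\<close>

text \<open>Multiplication by x as an operator on the whole algebra, so that recursions over
  argument lists become identities between linear operators.\<close>

definition left_wedge :: "'g::real_vector \<Rightarrow> 'g ext \<Rightarrow> 'g ext"
  where "left_wedge x = lin_ext (\<lambda>xs. wedge (x # xs))"

lemma linear_left_wedge: "linear (left_wedge x)"
  and left_wedge_wedge [simp]: "left_wedge x (wedge xs) = wedge (x # xs)"
  using lin_ext[OF alternating_multilinear_Cons[OF wedge_alternating_multilinear]]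
  by (auto simp: left_wedge_def)

lemma left_wedge_add: "left_wedge (x + y) p = left_wedge x p + left_wedge y p"
  by (rule linear_eq_on_wedge[OF linear_left_wedge linear_compose_add[OF linear_left_wedge linear_left_wedge]])
    (use alternating_multilinearD(1)[OF wedge_alternating_multilinear, of "[]"] in simp)

lemma left_wedge_scale: "left_wedge (c *\<^sub>R x) p = c *\<^sub>R left_wedge x p"
  by (rule linear_eq_on_wedge[OF linear_left_wedge linear_compose_scale_right[OF linear_left_wedge]])
    (use alternating_multilinearD(2)[OF wedge_alternating_multilinear, of "[]"] in simp)

lemma left_wedge_swap: "left_wedge x (left_wedge y p) = - left_wedge y (left_wedge x p)"
  by (rule linear_eq_on_wedge[OF linear_compose[OF linear_left_wedge linear_left_wedge, unfolded o_def]
        linear_compose_neg[OF linear_compose[OF linear_left_wedge linear_left_wedge, unfolded o_def]]])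
    (use alternating_multilinear_swap[OF wedge_alternating_multilinear, of "[]"] in simp)

lemma left_wedge_same: "left_wedge x (left_wedge x p) = 0"
  by (rule linear_eq_on_wedge[OF linear_compose[OF linear_left_wedge linear_left_wedge, unfolded o_def] linear_zero])
    (use alternating_multilinearD(3)[OF wedge_alternating_multilinear, of "[]"] in simp)

text \<open>Omissions are sorted by whether the head is among the omitted entries. Splitting index
  sums in this way produces the recursions for ad, \<delta> and d.\<close>

lemma nths_omit:
  "nths (x # xs) (- {0}) = xs"
  "nths (x # xs) (- {Suc i}) = x # nths xs (- {i})"
  "nths (x # xs) (- {0, Suc i}) = nths xs (- {i})"
  "nths (x # xs) (- {Suc i, Suc j}) = x # nths xs (- {i, j})"
  by (simp_all add: nths_Cons Compl_eq nths_all)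

lemma length_nths_omit: "i < length xs \<Longrightarrow> length (nths xs (- {i})) = length xs - 1"
proof (induction xs arbitrary: i)
  case (Cons x xs)
  then show ?case by (cases i; cases xs) (auto simp: nths_omit)
qed simp

text \<open>The recursions \<open>ad\<^sub>x(y \<and> p) = [x, y] \<and> p + y \<and> ad\<^sub>x p\<close> and
  \<open>\<delta>(x \<and> p) = - ad\<^sub>x p - x \<and> \<delta> p\<close> replace the index sums of the definitions.\<close>

primrec ad_wedge :: "('g::real_vector \<Rightarrow> 'g \<Rightarrow> 'g) \<Rightarrow> 'g \<Rightarrow> 'g list \<Rightarrow> 'g ext"
  where
    "ad_wedge br x [] = 0"
  | "ad_wedge br x (y # ys) = wedge (br x y # ys) + left_wedge y (ad_wedge br x ys)"

primrec delta_wedge :: "('g::real_vector \<Rightarrow> 'g \<Rightarrow> 'g) \<Rightarrow> 'g list \<Rightarrow> 'g ext"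
  where
    "delta_wedge br [] = 0"
  | "delta_wedge br (x # xs) = - ad_wedge br x xs - left_wedge x (delta_wedge br xs)"

lemmas left_wedge_linear_simps =
  linear_add[OF linear_left_wedge] linear_diff[OF linear_left_wedge] linear_neg[OF linear_left_wedge]
  linear_scale[OF linear_left_wedge] linear_0[OF linear_left_wedge]

lemma ad_wedge_eq_sum: "(\<Sum>i<length xs. wedge (xs[i := br x (xs ! i)])) = ad_wedge br x xs"
proof (induction xs)
  case (Cons y ys)
  have "(\<Sum>i<length ys. wedge (y # ys[i := br x (ys ! i)])) =
      left_wedge y (\<Sum>i<length ys. wedge (ys[i := br x (ys ! i)]))"
    by (simp add: linear_sum[OF linear_left_wedge])
  then show ?case
    by (simp add: sum.lessThan_Suc_shift Cons.IH del: sum.lessThan_Suc)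
qed simp

lemma wedge_swap: "wedge (x # y # xs) = - left_wedge y (wedge (x # xs))"
  using left_wedge_swap[of x y "wedge xs"] by simp

text \<open>Carrying the front entry into the gap at place i passes i factors, hence the
  sign.\<close>

lemma wedge_move:
  "i < length xs \<Longrightarrow> wedge (z # nths xs (- {i})) = (-1) ^ i *\<^sub>R wedge (xs[i := z])"
proof (induction xs arbitrary: i)
  case (Cons x xs)
  show ?case
  proof (cases i)
    case 0
    then show ?thesis by (simp add: nths_omit)
  next
    case (Suc j)
    then have "wedge (z # nths (x # xs) (- {i})) = - left_wedge x (wedge (z # nths xs (- {j})))"
      by (simp only: nths_omit wedge_swap)
    then show ?thesis using Cons Suc by (simp add: left_wedge_linear_simps del: left_wedge_wedge) simp
  qed
qed simp

text \<open>The pairs i < j are sorted by whether i = 0. Counting from 0 instead of 1 shifts both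
  indices, so \<open>(-1) ^ (i + j)\<close> is the usual sign.\<close>

lemma delta_wedge_eq_sum:
  "(\<Sum>j<length xs. \<Sum>i<j. (-1) ^ (i + j) *\<^sub>R wedge (br (xs ! i) (xs ! j) # nths xs (- {i, j}))) =
    delta_wedge br xs"
proof (induction xs)
  case (Cons x xs)
  let ?g = "\<lambda>i j. (-1) ^ (i + j) *\<^sub>R wedge (br (xs ! i) (xs ! j) # nths xs (- {i, j}))"
  let ?f = "\<lambda>i j. (-1) ^ (i + j) *\<^sub>R
    wedge (br ((x # xs) ! i) ((x # xs) ! j) # nths (x # xs) (- {i, j}))"
  \<comment> \<open>\<open>(-1) ^ Suc j\<close> meets \<open>(-1) ^ j\<close> from moving the
    bracket into the slot of its second entry. One minus survives, and the sum over j is -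
    ad.\<close>
  have first: "?f 0 (Suc j) = - wedge (xs[j := br x (xs ! j)])" if "j < length xs" for j
    using wedge_move[OF that] by (simp add: nths_omit)
  \<comment> \<open>Shifting both indices keeps the sign; the minus comes from moving x past the
    bracket to the front.\<close>
  have rest: "?f (Suc i) (Suc j) = - left_wedge x (?g i j)" for i j
    using wedge_swap[of _ x] by (simp add: nths_omit left_wedge_linear_simps del: left_wedge_wedge)
  have "(\<Sum>j<length (x # xs). \<Sum>i<j. ?f i j) = (\<Sum>j<length xs. ?f 0 (Suc j) + (\<Sum>i<j. ?f (Suc i) (Suc j)))"
    by (simp add: sum.lessThan_Suc_shift del: sum.lessThan_Suc)
  also have "\<dots> = (\<Sum>j<length xs. - wedge (xs[j := br x (xs ! j)]) + (\<Sum>i<j. - left_wedge x (?g i j)))"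
    by (rule sum.cong) (simp_all only: first rest lessThan_iff)
  also have "\<dots> = - ad_wedge br x xs - left_wedge x (\<Sum>j<length xs. \<Sum>i<j. ?g i j)"
    by (simp only: sum.distrib sum_negf ad_wedge_eq_sum linear_sum[OF linear_left_wedge]) simp
  finally show ?case
    by (simp only: Cons.IH delta_wedge.simps)
qed simp

section \<open>Commutation relations between ad, \<delta> and the wedge\<close>

locale lie_alg =
  fixes br :: "'g::real_vector \<Rightarrow> 'g \<Rightarrow> 'g"
  assumes lie_algebra: "lie_algebra br"
begin

lemma br_simps:
  "br (x + y) z = br x z + br y z" "br z (x + y) = br z x + br z y"
  "br (c *\<^sub>R x) z = c *\<^sub>R br x z" "br z (c *\<^sub>R x) = c *\<^sub>R br z x" "br x x = 0"
  using lie_algebra unfolding lie_algebra_def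
  by (auto simp: bilinear_ladd bilinear_radd bilinear_lmul bilinear_rmul)

lemma br_swap: "br x y = - br y x"
proof -
  have "br x x + br y x + (br x y + br y y) = br (x + y) (x + y)"
    by (simp only: br_simps(1,2))
  then have "br y x + br x y = 0" by (simp only: br_simps) simp
  then show ?thesis by (simp add: eq_neg_iff_add_eq_0 add.commute)
qed

lemma jacobi: "br (br x y) z = br x (br y z) - br y (br x z)"
proof -
  have "br x (br y z) + br y (br z x) + br z (br x y) = 0"
    using lie_algebra by (auto simp: lie_algebra_def)
  moreover have "br y (br z x) = - br y (br x z)"
    using br_swap[of z x] br_simps(4)[of y "-1" "br x z"] by simp
  moreover have "br z (br x y) = - br (br x y) z" by (rule br_swap)
  ultimately show ?thesis by (simp add: algebra_simps)
qed

text \<open>In \<open>delta_wedge\<close> each entry also serves as the acting element of ad, so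
  multilinearity of the boundary needs linearity of ad in that element.\<close>

lemma ad_wedge_add: "ad_wedge br (x + y) xs = ad_wedge br x xs + ad_wedge br y xs"
  by (induction xs) (simp_all add: br_simps left_wedge_add left_wedge_linear_simps flip: left_wedge_wedge)

lemma ad_wedge_scale: "ad_wedge br (c *\<^sub>R x) xs = c *\<^sub>R ad_wedge br x xs"
  by (induction xs)
    (simp_all add: br_simps left_wedge_scale left_wedge_linear_simps scaleR_add_right flip: left_wedge_wedge)

lemma alternating_multilinear_ad_wedge: "alternating_multilinear (ad_wedge br x)"
proof (rule alternating_multilinearI)
  note w = alternating_multilinearD[OF wedge_alternating_multilinear]
  note w' = w[of "_ # _", simplified]
  fix us vs and y z :: 'g and c :: real
  show "ad_wedge br x (us @ [y + z] @ vs) = ad_wedge br x (us @ [y] @ vs) + ad_wedge br x (us @ [z] @ vs)"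
    by (induction us)
      (simp_all add: br_simps w' left_wedge_add left_wedge_linear_simps w(1)[of "[]", simplified])
  show "ad_wedge br x (us @ [c *\<^sub>R y] @ vs) = c *\<^sub>R ad_wedge br x (us @ [y] @ vs)"
    by (induction us)
      (simp_all add: br_simps w' left_wedge_scale left_wedge_linear_simps w(2)[of "[]", simplified] scaleR_add_right)
  show "ad_wedge br x (us @ [y, y] @ vs) = 0"
  proof (induction us)
    case Nil
    \<comment> \<open>With y repeated, \<open>[x, y] \<and> y\<close> and
      \<open>y \<and> [x, y]\<close> cancel, and the remaining term contains y twice.\<close>
    then show ?case
      using wedge_swap[of "br x y" y vs] by (simp add: left_wedge_linear_simps left_wedge_same)
  qed (simp_all add: w' left_wedge_linear_simps)
qed

lemma linear_ad_ext: "linear (ad_ext br x)"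
  and ad_ext_wedge: "ad_ext br x (wedge xs) = ad_wedge br x xs"
  using lin_ext[OF alternating_multilinear_ad_wedge] by (simp_all add: ad_ext_def ad_wedge_eq_sum)

lemmas ad_ext_linear_simps =
  linear_add[OF linear_ad_ext] linear_diff[OF linear_ad_ext] linear_neg[OF linear_ad_ext]
  linear_scale[OF linear_ad_ext] linear_0[OF linear_ad_ext]

lemma ad_ext_left_wedge: "ad_ext br x (left_wedge y p) = left_wedge (br x y) p + left_wedge y (ad_ext br x p)"
  by (rule linear_eq_on_wedge)
    (auto intro!: linear_compose_add linear_compose[OF linear_left_wedge linear_ad_ext, unfolded o_def]
      linear_compose[OF linear_ad_ext linear_left_wedge, unfolded o_def] linear_left_wedge
      simp: ad_ext_wedge)

lemma alternating_multilinear_delta_wedge: "alternating_multilinear (delta_wedge br)"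
proof (rule alternating_multilinearI)
  note a = alternating_multilinearD[OF alternating_multilinear_ad_wedge]
  fix us vs and x y :: 'g and c :: real
  show "delta_wedge br (us @ [x + y] @ vs) = delta_wedge br (us @ [x] @ vs) + delta_wedge br (us @ [y] @ vs)"
    by (induction us) (simp_all add: ad_wedge_add a left_wedge_add left_wedge_linear_simps)
  show "delta_wedge br (us @ [c *\<^sub>R x] @ vs) = c *\<^sub>R delta_wedge br (us @ [x] @ vs)"
    by (induction us)
      (simp_all add: ad_wedge_scale a left_wedge_scale left_wedge_linear_simps scaleR_diff_right)
  show "delta_wedge br (us @ [x, x] @ vs) = 0"
  proof (induction us)
    case Nil
    \<comment> \<open>The terms \<open>x \<and> ad\<^sub>x\<close> cancel; what is left contains
      \<open>[x, x] = 0\<close> or x twice. The instance of \<open>left_wedge_scale\<close> with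
      scalar 0 says that a wedge with an entry 0 vanishes.\<close>
    then show ?case
      using linear_0[OF linear_left_wedge] left_wedge_scale[of 0 0 "wedge vs"]
      by (simp add: br_simps left_wedge_linear_simps left_wedge_same)
  qed (simp_all add: a left_wedge_linear_simps)
qed

lemma linear_delta: "linear (delta br)"
  and delta_wedge: "delta br (wedge xs) = delta_wedge br xs"
  using lin_ext[OF alternating_multilinear_delta_wedge] by (simp_all add: delta_def delta_wedge_eq_sum)

lemmas delta_linear_simps =
  linear_add[OF linear_delta] linear_diff[OF linear_delta] linear_neg[OF linear_delta]
  linear_scale[OF linear_delta] linear_0[OF linear_delta]

text \<open>The recursion as an operator identity: \<delta> and the wedge with x anticommute up to -
  ad, the counterpart of Cartan's formula for d and contraction.\<close>

lemma delta_left_wedge: "delta br (left_wedge x p) = - ad_ext br x p - left_wedge x (delta br p)"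
  by (rule linear_eq_on_wedge)
    (auto intro!: linear_compose_sub linear_compose_neg linear_compose[OF linear_left_wedge linear_delta, unfolded o_def]
      linear_compose[OF linear_delta linear_left_wedge, unfolded o_def] linear_ad_ext
      simp: ad_ext_wedge delta_wedge)

lemma ad_ext_add: "ad_ext br (x + y) p = ad_ext br x p + ad_ext br y p"
  by (rule linear_eq_on_wedge)
    (auto intro!: linear_compose_add linear_ad_ext simp: ad_ext_wedge ad_wedge_add)

lemma ad_ext_scale: "ad_ext br (c *\<^sub>R x) p = c *\<^sub>R ad_ext br x p"
  by (rule linear_eq_on_wedge)
    (auto intro!: linear_compose_scale_right linear_ad_ext simp: ad_ext_wedge ad_wedge_scale)

text \<open>In the commutator of two derivations the mixed terms cancel; the factor z contributes
  the Jacobi identity, the rest is the induction hypothesis.\<close>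

lemma ad_ext_br: "ad_ext br (br x y) p = ad_ext br x (ad_ext br y p) - ad_ext br y (ad_ext br x p)"
proof (rule linear_eq_on_wedge[where f = "ad_ext br (br x y)"
      and g = "\<lambda>p. ad_ext br x (ad_ext br y p) - ad_ext br y (ad_ext br x p)"])
  fix xs
  show "ad_ext br (br x y) (wedge xs) =
      ad_ext br x (ad_ext br y (wedge xs)) - ad_ext br y (ad_ext br x (wedge xs))"
  proof (induction xs)
    case Nil
    then show ?case by (simp add: ad_ext_wedge ad_ext_linear_simps)
  next
    case (Cons z zs)
    have "left_wedge (br (br x y) z) p = left_wedge (br x (br y z)) p - left_wedge (br y (br x z)) p" for p
      using left_wedge_add[of "br x (br y z) - br y (br x z)" "br y (br x z)" p]
      by (simp add: jacobi)
    with Cons show ?case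
      by (simp add: ad_ext_left_wedge ad_ext_linear_simps left_wedge_linear_simps
          del: left_wedge_wedge flip: left_wedge_wedge)
  qed
qed (auto intro!: linear_compose_sub linear_ad_ext linear_compose[OF linear_ad_ext linear_ad_ext, unfolded o_def])

text \<open>On \<open>z \<and> p\<close> the terms \<open>[x, z] \<and> \<delta> p\<close> agree,
  the terms in ad alone match by \<open>ad_ext_br\<close>, and the terms starting with z are the
  induction hypothesis.\<close>

lemma delta_ad_ext: "delta br (ad_ext br x p) = ad_ext br x (delta br p)"
proof (rule linear_eq_on_wedge[where f = "\<lambda>p. delta br (ad_ext br x p)"
      and g = "\<lambda>p. ad_ext br x (delta br p)"])
  fix xs
  show "delta br (ad_ext br x (wedge xs)) = ad_ext br x (delta br (wedge xs))"
  proof (induction xs)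
    case Nil
    then show ?case by (simp add: ad_ext_wedge delta_wedge ad_ext_linear_simps delta_linear_simps)
  next
    case (Cons z zs)
    then show ?case
      by (simp add: ad_ext_left_wedge delta_left_wedge ad_ext_br ad_ext_linear_simps
          delta_linear_simps left_wedge_linear_simps del: left_wedge_wedge flip: left_wedge_wedge)
  qed
qed (auto intro!: linear_compose[OF linear_ad_ext linear_delta, unfolded o_def]
      linear_compose[OF linear_delta linear_ad_ext, unfolded o_def])

end

section \<open>Degrees in the exterior algebra\<close>

lemma wedge_in_ext_power: "wedge xs \<in> ext_power (length xs)"
  unfolding ext_power_def by (rule span_base) blast

lemma subspace_ext_power: "subspace (ext_power k)"
  by (simp add: ext_power_def)

text \<open>The tool for all statements on degrees; with \<open>W = {0}\<close> it yields vanishing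
  on a whole exterior power.\<close>

lemma linear_image_ext_power:
  assumes "linear L" "subspace W" "\<And>xs. length xs = k \<Longrightarrow> L (wedge xs) \<in> W" "p \<in> ext_power k"
  shows "L p \<in> W"
  using assms(4)
  by (induction rule: ext_power_induct)
    (use assms in \<open>auto simp: linear_add linear_scale linear_0 subspace_add subspace_scale subspace_0\<close>)

lemma left_wedge_ext_power: "p \<in> ext_power k \<Longrightarrow> left_wedge x p \<in> ext_power (Suc k)"
  by (rule linear_image_ext_power[OF linear_left_wedge subspace_ext_power])
    (use wedge_in_ext_power[of "x # _"] in auto)

lemma ad_wedge_in_ext_power: "ad_wedge br x xs \<in> ext_power (length xs)"
proof (induction xs)
  case (Cons y ys)
  then show ?case
    using wedge_in_ext_power[of "br x y # ys"]
    by (simp add: subspace_add[OF subspace_ext_power] left_wedge_ext_power)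
qed (simp add: subspace_0[OF subspace_ext_power])

lemma delta_wedge_in_ext_power: "delta_wedge br xs \<in> ext_power (length xs - 1)"
proof (induction xs)
  case (Cons x xs)
  \<comment> \<open>For empty xs the induction hypothesis yields degree 1 instead of 0, since
    \<open>0 - 1 = 0\<close>; but then the boundary, and with it the wedge, is 0.\<close>
  have "left_wedge x (delta_wedge br xs) \<in> ext_power (length xs)"
    using left_wedge_ext_power[OF Cons, of x]
    by (cases xs) (simp_all add: subspace_0[OF subspace_ext_power] left_wedge_linear_simps)
  then show ?case
    using ad_wedge_in_ext_power[of br x xs]
    by (simp add: subspace_diff[OF subspace_ext_power] subspace_neg[OF subspace_ext_power])
qed (simp add: subspace_0[OF subspace_ext_power])

context lie_alg
begin

lemma ad_ext_in_ext_power: "p \<in> ext_power k \<Longrightarrow> ad_ext br x p \<in> ext_power k"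
  by (rule linear_image_ext_power[OF linear_ad_ext subspace_ext_power])
    (use ad_wedge_in_ext_power in \<open>auto simp: ad_ext_wedge\<close>)

lemma delta_in_ext_power: "p \<in> ext_power k \<Longrightarrow> delta br p \<in> ext_power (k - 1)"
  by (rule linear_image_ext_power[OF linear_delta subspace_ext_power])
    (use delta_wedge_in_ext_power in \<open>auto simp: delta_wedge\<close>)

text \<open>Complements \<open>delta_in_ext_power\<close>, which is too weak in low degrees, where
  \<open>k - 1\<close> is 0 for k = 0 and for k = 1.\<close>

lemma delta_ext_power_1: "p \<in> ext_power k \<Longrightarrow> k \<le> 1 \<Longrightarrow> delta br p = 0"
proof -
  assume p: "p \<in> ext_power k" "k \<le> 1"
  have "delta br p \<in> {0}"
    by (rule linear_image_ext_power[OF linear_delta subspace_single_0 _ p(1)])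
      (use p(2) in \<open>auto simp: delta_wedge le_Suc_eq length_Suc_conv left_wedge_linear_simps\<close>)
  then show ?thesis by simp
qed

end

section \<open>The algebra of smooth functions\<close>

text \<open>A partial derivative at x sees the function only along a coordinate line, and openness
  keeps the part of the line near x inside W. The points of the Euclidean space vanish from index d
  on, so \<open>i < d\<close> keeps the line in the space.\<close>

lemma eventually_in_open_coordinate:
  assumes "openin (Euclidean_space d) W" "x \<in> W" "i < d"
  shows "\<forall>\<^sub>F t in nhds (x i). x(i := t) \<in> W"
proof -
  have x: "x \<in> topspace (Euclidean_space d)"
    using assms openin_subset by blast
  have "continuous_map euclideanreal (powertop_real UNIV) (\<lambda>t. x(i := t))"
    by (subst continuous_map_componentwise_UNIV) (auto simp: fun_upd_apply)
  then have "continuous_map euclideanreal (Euclidean_space d) (\<lambda>t. x(i := t))"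
    using x assms(3)
    by (auto simp: Euclidean_space_def continuous_map_in_subtopology)
  from openin_continuous_map_preimage[OF this assms(1)]
  have "open {t. x(i := t) \<in> W}" by simp
  then show ?thesis
    using assms(2) by (auto simp: eventually_nhds intro!: exI[of _ "{t. x(i := t) \<in> W}"])
qed

text \<open>The sum and product rules for \<open>partial_deriv\<close> are available only on W,
  where differentiability is known. Locality allows the derivative to be replaced by the expression
  that the rule gives there.\<close>

lemma C_k_cong:
  assumes "openin (Euclidean_space d) W" "\<And>x. x \<in> W \<Longrightarrow> f x = g x" "C_k d W k f"
  shows "C_k d W k g"
  using assms(2,3)
proof (induction k arbitrary: f g)
  case 0
  then show ?case by (auto intro: continuous_map_eq)
next
  case (Suc k)
  have ev: "\<forall>\<^sub>F t in nhds (x i). f (x(i := t)) = g (x(i := t))" if "x \<in> W" "i < d" for x i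
    by (rule eventually_mono[OF eventually_in_open_coordinate[OF assms(1) that]]) (rule Suc.prems(1))
  have "(\<lambda>t. g (x(i := t))) differentiable at (x i)" if "x \<in> W" "i < d" for x i
  proof -
    have "(\<lambda>t. f (x(i := t))) differentiable at (x i)" using Suc.prems(2) that by simp
    then show ?thesis
      unfolding real_differentiable_def using DERIV_cong_ev[OF refl ev[OF that] refl] by blast
  qed
  moreover have "C_k d W k (partial_deriv i g)" if "i < d" for i
  proof (rule Suc.IH)
    show "partial_deriv i f x = partial_deriv i g x" if "x \<in> W" for x
      unfolding partial_deriv_def by (rule deriv_cong_ev[OF ev[OF that \<open>i < d\<close>] refl])
    show "C_k d W k (partial_deriv i f)" using Suc.prems(2) that by simp
  qed
  moreover have "continuous_map (subtopology (Euclidean_space d) W) euclideanreal g"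
    by (rule continuous_map_eq[of _ _ f]) (use Suc.prems in auto)
  ultimately show ?case by simp
qed

lemma C_k_SucD: "C_k d W (Suc k) f \<Longrightarrow> C_k d W k f"
  by (induction k arbitrary: f) auto

lemma C_k_const: "C_k d W k (\<lambda>_. c)"
proof (induction k arbitrary: c)
  case (Suc k)
  have "partial_deriv i (\<lambda>_. c) = (\<lambda>_. 0)" for i
    by (auto simp: partial_deriv_def)
  then show ?case using Suc by simp
qed simp

lemma C_k_add:
  assumes "openin (Euclidean_space d) W" "C_k d W k f" "C_k d W k g"
  shows "C_k d W k (\<lambda>x. f x + g x)"
  using assms(2,3)
proof (induction k arbitrary: f g)
  case 0
  then show ?case by (auto intro: continuous_map_add)
next
  case (Suc k)
  have "C_k d W k (partial_deriv i (\<lambda>x. f x + g x))" if "i < d" for i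
  proof (rule C_k_cong[OF assms(1)])
    show "C_k d W k (\<lambda>x. partial_deriv i f x + partial_deriv i g x)"
      using Suc that by simp
    fix x assume "x \<in> W"
    with Suc.prems that show "partial_deriv i f x + partial_deriv i g x = partial_deriv i (\<lambda>x. f x + g x) x"
      by (auto simp: partial_deriv_def field_differentiable_def real_differentiable_def
          intro!: deriv_add[symmetric])
  qed
  with Suc.prems show ?case
    by (auto intro: continuous_map_add differentiable_add)
qed

text \<open>By the Leibniz rule the undifferentiated factors enter the induction hypothesis one
  order lower, hence \<open>C_k_SucD\<close>.\<close>

lemma C_k_mult:
  assumes "openin (Euclidean_space d) W" "C_k d W k f" "C_k d W k g"
  shows "C_k d W k (\<lambda>x. f x * g x)"
  using assms(2,3)
proof (induction k arbitrary: f g)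
  case 0
  then show ?case by (auto intro: continuous_map_real_mult)
next
  case (Suc k)
  have "C_k d W k (partial_deriv i (\<lambda>x. f x * g x))" if "i < d" for i
  proof (rule C_k_cong[OF assms(1)])
    show "C_k d W k (\<lambda>x. f x * partial_deriv i g x + partial_deriv i f x * g x)"
      using Suc.prems that by (intro C_k_add[OF assms(1)] Suc.IH) (auto intro: C_k_SucD)
    fix x assume "x \<in> W"
    with Suc.prems that deriv_mult[of "\<lambda>t. f (x(i := t))" "x i" "\<lambda>t. g (x(i := t))"]
    show "f x * partial_deriv i g x + partial_deriv i f x * g x = partial_deriv i (\<lambda>x. f x * g x) x"
      by (auto simp: partial_deriv_def field_differentiable_def real_differentiable_def)
  qed
  with Suc.prems show ?case
    by (auto intro: continuous_map_real_mult differentiable_mult)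
qed

lemma scaleR_fun_apply: "(c *\<^sub>R f) x = c *\<^sub>R f x"
  by (simp add: scaleR_fun_def)

text \<open>Evaluation of pointwise operations by the simplifier leads to unwanted \<open>\<eta>\<close>-expansions
  of sums of forms.\<close>

declare plus_fun_apply [simp del] zero_fun_apply [simp del] times_fun_apply [simp del]
  minus_apply [simp del] uminus_apply [simp del]

lemmas fun_apply_simps = plus_fun_apply zero_fun_apply times_fun_apply minus_apply uminus_apply scaleR_fun_apply

lemma form_apply_simps:
  fixes u w :: "'a \<Rightarrow> 'b \<Rightarrow> real"
  shows "(u + w) x = u x + w x" "(u - w) x = u x - w x" "(- u) x = - u x" "(c *\<^sub>R u) x = c *\<^sub>R u x"
    "(0 :: 'a \<Rightarrow> 'b \<Rightarrow> real) x = 0"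
  by (simp_all only: fun_apply_simps)

lemma mult_scaleR_fun: "(f :: 'a \<Rightarrow> real) * c *\<^sub>R g = c *\<^sub>R (f * g)"
  by (simp add: fun_eq_iff fun_apply_simps)

lemma eq_plusI: "(\<And>x. f x = g x + h x) \<Longrightarrow> f = g + h"
  by (simp add: fun_eq_iff fun_apply_simps)

lemma eq_minusI: "(\<And>x. f x = g x - h x) \<Longrightarrow> f = g - h"
  by (simp add: fun_eq_iff fun_apply_simps)

lemma eq_uminusI: "(\<And>x. f x = - g x) \<Longrightarrow> f = - g"
  by (simp add: fun_eq_iff fun_apply_simps)

lemma eq_scaleRI: "(\<And>x. f x = c *\<^sub>R g x) \<Longrightarrow> f = c *\<^sub>R g"
  by (simp add: fun_eq_iff fun_apply_simps)

locale smooth_mfd =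
  fixes M :: "'m::{t2_space, second_countable_topology} manifold"
  assumes smooth_manifold: "smooth_manifold M"
begin

abbreviation "SF \<equiv> smooth_functions M"
abbreviation "VF \<equiv> vector_fields M"

lemma openin_chart: "(U, \<phi>) \<in> charts M \<Longrightarrow> openin (Euclidean_space (mfd_dim M)) (\<phi> ` U)"
  using smooth_manifold by (force simp: smooth_manifold_def)

lemma SF_const: "(\<lambda>_. c) \<in> SF"
  by (auto simp: smooth_functions_def C_infinity_def o_def C_k_const)

lemma SF_add: "f \<in> SF \<Longrightarrow> g \<in> SF \<Longrightarrow> f + g \<in> SF"
  by (auto simp: smooth_functions_def C_infinity_def o_def plus_fun_apply intro!: C_k_add openin_chart)

lemma SF_mult: "f \<in> SF \<Longrightarrow> g \<in> SF \<Longrightarrow> f * g \<in> SF"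
  by (auto simp: smooth_functions_def C_infinity_def o_def times_fun_apply intro!: C_k_mult openin_chart)

lemma SF_scale: "f \<in> SF \<Longrightarrow> c *\<^sub>R f \<in> SF"
proof -
  have "c *\<^sub>R f = (\<lambda>_. c) * f" by (auto simp: fun_eq_iff fun_apply_simps)
  then show "f \<in> SF \<Longrightarrow> c *\<^sub>R f \<in> SF" using SF_mult[OF SF_const] by simp
qed

lemma subspace_SF: "subspace SF"
  using SF_const[of 0] by (auto simp: subspace_def SF_add SF_scale zero_fun_def)

lemmas SF_0 = subspace_0[OF subspace_SF]
lemmas SF_diff = subspace_diff[OF subspace_SF]
lemmas SF_sum = subspace_sum[OF subspace_SF]

section \<open>The Lie algebra of vector fields\<close>

lemma VF_simps:
  assumes "X \<in> VF"
  shows "f \<in> SF \<Longrightarrow> X f \<in> SF" "f \<in> SF \<Longrightarrow> g \<in> SF \<Longrightarrow> X (f + g) = X f + X g"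
    "f \<in> SF \<Longrightarrow> X (c *\<^sub>R f) = c *\<^sub>R X f" "f \<in> SF \<Longrightarrow> g \<in> SF \<Longrightarrow> X (f * g) = f * X g + g * X f"
    "f \<notin> SF \<Longrightarrow> X f = 0"
  using assms by (auto simp: vector_fields_def)

lemma VF_0: "X \<in> VF \<Longrightarrow> X 0 = 0"
  using VF_simps(3)[of X 0 0] SF_0 by simp

lemma VF_diff:
  assumes "X \<in> VF" "f \<in> SF" "g \<in> SF"
  shows "X (f - g) = X f - X g"
  using VF_simps(2)[OF assms(1) SF_diff[OF assms(2,3)] assms(3)] by simp

lemma VF_I:
  assumes "\<And>f. f \<in> SF \<Longrightarrow> X f \<in> SF" "\<And>f g. f \<in> SF \<Longrightarrow> g \<in> SF \<Longrightarrow> X (f + g) = X f + X g"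
    "\<And>f c. f \<in> SF \<Longrightarrow> X (c *\<^sub>R f) = c *\<^sub>R X f" "\<And>f g. f \<in> SF \<Longrightarrow> g \<in> SF \<Longrightarrow> X (f * g) = f * X g + g * X f"
    "\<And>f. f \<notin> SF \<Longrightarrow> X f = 0"
  shows "X \<in> VF"
  using assms by (auto simp: vector_fields_def)

lemma subspace_VF: "subspace VF"
proof (rule subspaceI)
  show "0 \<in> VF" by (rule VF_I) (simp_all add: SF_0 form_apply_simps)
  fix X Y and c :: real assume X: "X \<in> VF" and Y: "Y \<in> VF"
  show "X + Y \<in> VF"
    by (rule VF_I) (simp_all add: VF_simps[OF X] VF_simps[OF Y] SF_add form_apply_simps algebra_simps)
  show "c *\<^sub>R X \<in> VF"
    by (rule VF_I) (simp_all add: VF_simps[OF X] SF_scale form_apply_simps scaleR_add_right mult_scaleR_fun)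
qed

lemma VF_mult: "f \<in> SF \<Longrightarrow> X \<in> VF \<Longrightarrow> (\<lambda>g. f * X g) \<in> VF"
  by (rule VF_I) (auto simp: VF_simps SF_mult algebra_simps fun_eq_iff fun_apply_simps)

lemma VF_bracket:
  assumes X: "X \<in> VF" and Y: "Y \<in> VF"
  shows "vf_bracket X Y \<in> VF"
  by (rule VF_I)
    (simp_all add: vf_bracket_def VF_simps[OF X] VF_simps[OF Y] VF_0[OF X] VF_0[OF Y]
      SF_diff SF_mult SF_add algebra_simps)

lemma vf_bracket_add_right:
  assumes X: "X \<in> VF" and Y: "Y \<in> VF" and Z: "Z \<in> VF"
  shows "vf_bracket X (Y + Z) = vf_bracket X Y + vf_bracket X Z"
proof
  fix f
  show "vf_bracket X (Y + Z) f = (vf_bracket X Y + vf_bracket X Z) f"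
    by (cases "f \<in> SF")
      (simp_all add: vf_bracket_def VF_simps[OF X] VF_simps[OF Y] VF_simps[OF Z] VF_0[OF X] form_apply_simps algebra_simps)
qed

text \<open>The term with \<open>X f\<close> is what cancels the derivative of the coefficient in
  \<open>lie_deriv_forms\<close>.\<close>

lemma vf_bracket_mult_right:
  assumes X: "X \<in> VF" and Y: "Y \<in> VF" and f: "f \<in> SF"
  shows "vf_bracket X (\<lambda>g. f * Y g) = (\<lambda>g. f * vf_bracket X Y g) + (\<lambda>g. X f * Y g)"
proof
  fix g
  show "vf_bracket X (\<lambda>g. f * Y g) g = ((\<lambda>g. f * vf_bracket X Y g) + (\<lambda>g. X f * Y g)) g"
    by (cases "g \<in> SF")
      (simp_all add: vf_bracket_def VF_simps[OF X] VF_simps[OF Y] VF_0[OF X] VF_0[OF Y] f form_apply_simps algebra_simps)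
qed

lemma vf_bracket_add_left: "vf_bracket (X + Y) Z = vf_bracket X Z + vf_bracket Y Z"
  if "X \<in> VF" "Y \<in> VF" "Z \<in> VF"
  using vf_bracket_add_right[OF that(3,1,2)] by (auto simp: vf_bracket_def fun_eq_iff fun_apply_simps)

lemma vf_bracket_scale_left:
  assumes X: "X \<in> VF" and Y: "Y \<in> VF"
  shows "vf_bracket (c *\<^sub>R X) Y = c *\<^sub>R vf_bracket X Y"
proof
  fix f
  show "vf_bracket (c *\<^sub>R X) Y f = (c *\<^sub>R vf_bracket X Y) f"
    by (cases "f \<in> SF")
      (simp_all add: vf_bracket_def VF_simps[OF X] VF_simps[OF Y] VF_0[OF X] VF_0[OF Y] form_apply_simps scaleR_diff_right)
qed

lemma vf_jacobi:
  assumes X: "X \<in> VF" and Y: "Y \<in> VF" and Z: "Z \<in> VF"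
  shows "vf_bracket (vf_bracket X Y) Z = vf_bracket X (vf_bracket Y Z) - vf_bracket Y (vf_bracket X Z)"
proof
  fix f
  show "vf_bracket (vf_bracket X Y) Z f = (vf_bracket X (vf_bracket Y Z) - vf_bracket Y (vf_bracket X Z)) f"
    by (cases "f \<in> SF")
      (simp_all add: vf_bracket_def VF_simps[OF X] VF_simps[OF Y] VF_simps[OF Z] VF_0[OF X] VF_0[OF Y]
        VF_0[OF Z] VF_diff[OF X] VF_diff[OF Y] VF_diff[OF Z] form_apply_simps algebra_simps)
qed

section \<open>Contraction, Lie derivative and exterior derivative\<close>

lemma forms_I:
  assumes "\<And>Xs. set Xs \<subseteq> VF \<Longrightarrow> w Xs \<in> SF"
    and "\<And>Xs. \<not> set Xs \<subseteq> VF \<Longrightarrow> w Xs = 0"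
    and "\<And>Us Vs X Y. X \<in> VF \<Longrightarrow> Y \<in> VF \<Longrightarrow> set Us \<subseteq> VF \<Longrightarrow> set Vs \<subseteq> VF \<Longrightarrow>
      w (Us @ (X + Y) # Vs) = w (Us @ X # Vs) + w (Us @ Y # Vs)"
    and "\<And>Us Vs X f. X \<in> VF \<Longrightarrow> f \<in> SF \<Longrightarrow> set Us \<subseteq> VF \<Longrightarrow> set Vs \<subseteq> VF \<Longrightarrow>
      w (Us @ (\<lambda>g. f * X g) # Vs) = f * w (Us @ X # Vs)"
    and "\<And>Xs. set Xs \<subseteq> VF \<Longrightarrow> \<not> distinct Xs \<Longrightarrow> w Xs = 0"
  shows "w \<in> forms M"
  using assms(1-4) assms(2,5) unfolding forms_def by (simp; blast)

lemma forms_D: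
  assumes "w \<in> forms M"
  shows "set Xs \<subseteq> VF \<Longrightarrow> w Xs \<in> SF"
    and "\<not> set Xs \<subseteq> VF \<Longrightarrow> w Xs = 0"
    and "X \<in> VF \<Longrightarrow> Y \<in> VF \<Longrightarrow> set Us \<subseteq> VF \<Longrightarrow> set Vs \<subseteq> VF \<Longrightarrow>
      w (Us @ (X + Y) # Vs) = w (Us @ X # Vs) + w (Us @ Y # Vs)"
    and "X \<in> VF \<Longrightarrow> f \<in> SF \<Longrightarrow> set Us \<subseteq> VF \<Longrightarrow> set Vs \<subseteq> VF \<Longrightarrow>
      w (Us @ (\<lambda>g. f * X g) # Vs) = f * w (Us @ X # Vs)"
    and "\<not> distinct Xs \<Longrightarrow> w Xs = 0"
  using assms unfolding forms_def by simp_all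

lemma forms_D_head:
  assumes "w \<in> forms M"
  shows "X \<in> VF \<Longrightarrow> Y \<in> VF \<Longrightarrow> set Vs \<subseteq> VF \<Longrightarrow> w ((X + Y) # Vs) = w (X # Vs) + w (Y # Vs)"
    and "X \<in> VF \<Longrightarrow> f \<in> SF \<Longrightarrow> set Vs \<subseteq> VF \<Longrightarrow> w ((\<lambda>g. f * X g) # Vs) = f * w (X # Vs)"
  using forms_D(3,4)[OF assms, where Us = "[]"] by simp_all

text \<open>Real scalars are constant smooth functions, so homogeneity is a case of linearity over
  functions.\<close>

lemma forms_scale_slot:
  assumes "w \<in> forms M" "X \<in> VF" "set Us \<subseteq> VF" "set Vs \<subseteq> VF"
  shows "w (Us @ (c *\<^sub>R X) # Vs) = c *\<^sub>R w (Us @ X # Vs)"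
proof -
  have "c *\<^sub>R X = (\<lambda>g. (\<lambda>_. c) * X g)" by (auto simp: fun_eq_iff fun_apply_simps)
  show ?thesis
    unfolding \<open>c *\<^sub>R X = _\<close>
    using forms_D(4)[OF assms(1,2) SF_const assms(3,4), of c] by (simp add: fun_eq_iff fun_apply_simps)
qed

lemma subspace_forms: "subspace (forms M)"
proof (rule subspaceI)
  show "0 \<in> forms M" by (rule forms_I) (simp_all add: SF_0 form_apply_simps)
  fix u w and c :: real assume u: "u \<in> forms M" and w: "w \<in> forms M"
  show "u + w \<in> forms M"
    by (rule forms_I) (simp_all add: forms_D[OF u] forms_D[OF w] SF_add form_apply_simps algebra_simps)
  show "c *\<^sub>R u \<in> forms M"
    by (rule forms_I) (simp_all add: forms_D[OF u] SF_scale form_apply_simps scaleR_add_right mult_scaleR_fun)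
qed

lemmas forms_add = subspace_add[OF subspace_forms]
lemmas forms_diff = subspace_diff[OF subspace_forms]
lemmas forms_scale = subspace_scale[OF subspace_forms]
lemmas forms_0 = subspace_0[OF subspace_forms]

lemma contract_apply: "contract X w Ys = w (X # Ys)"
  by (simp add: contract_def)

lemma contract_simps [simp]:
  "contract X (u + w) = contract X u + contract X w"
  "contract X (u - w) = contract X u - contract X w" "contract X (c *\<^sub>R w) = c *\<^sub>R contract X w"
  "contract X 0 = 0"
  by (simp_all add: contract_def fun_eq_iff fun_apply_simps)

lemma contract_forms: "w \<in> forms M \<Longrightarrow> contract X w \<in> forms M"
proof (cases "X \<in> VF")
  case True
  assume w: "w \<in> forms M"
  show ?thesis
    using True
    by (intro forms_I)
      (simp_all add: contract_apply forms_D(1,2,5)[OF w] forms_D(3,4)[OF w, of _ _ "X # _", simplified])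
next
  case False
  assume "w \<in> forms M"
  then have "contract X w = 0" using False forms_D(2)[of w "X # _"] by (simp add: fun_eq_iff form_apply_simps contract_apply)
  then show ?thesis by (simp add: forms_0)
qed

lemma forms_swap:
  assumes w: "w \<in> forms M" and "X \<in> VF" "Y \<in> VF" "set Zs \<subseteq> VF"
  shows "w (X # Y # Zs) = - w (Y # X # Zs)"
proof -
  have XY: "X + Y \<in> VF" using assms subspace_add[OF subspace_VF] by blast
  have "0 = w ((X + Y) # (X + Y) # Zs)" using forms_D(5)[OF w] by simp
  also have "\<dots> = w (X # Y # Zs) + w (Y # X # Zs)"
    using assms XY forms_D(5)[OF w] forms_D_head(1)[OF w, of X Y "(X + Y) # Zs"]
      forms_D(3)[OF w, of X Y "[X]" Zs] forms_D(3)[OF w, of X Y "[Y]" Zs] by simp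
  finally show ?thesis by (simp add: eq_neg_iff_add_eq_0)
qed

section \<open>The Lie derivative\<close>

definition smooth_valued :: "'m form \<Rightarrow> bool"
  where "smooth_valued w \<longleftrightarrow> (\<forall>Ys. set Ys \<subseteq> VF \<longrightarrow> w Ys \<in> SF)"

lemma smooth_valued_forms: "w \<in> forms M \<Longrightarrow> smooth_valued w"
  by (simp add: smooth_valued_def forms_D)

lemma lie_deriv_Nil: "lie_deriv M X w [] = X (w [])"
  by (simp add: lie_deriv_def)

lemma lie_deriv_not_VF: "\<not> set Ys \<subseteq> VF \<Longrightarrow> lie_deriv M X w Ys = 0"
  by (simp add: lie_deriv_def)

text \<open>Slot 0 is split off the sum. This is the commutator of Lie derivative and contraction,
  evaluated on a list; the inductions on argument lists below run through it.\<close>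

lemma lie_deriv_Cons:
  "Y \<in> VF \<Longrightarrow> lie_deriv M X w (Y # Ys) = lie_deriv M X (contract Y w) Ys - w (vf_bracket X Y # Ys)"
  if "set Ys \<subseteq> VF"
  using that by (simp add: lie_deriv_def contract_apply sum.lessThan_Suc_shift del: sum.lessThan_Suc)

lemma update_subset_VF:
  "set Ys \<subseteq> VF \<Longrightarrow> X \<in> VF \<Longrightarrow> i < length Ys \<Longrightarrow> set (Ys[i := vf_bracket X (Ys ! i)]) \<subseteq> VF"
  by (intro set_update_subsetI VF_bracket) auto

lemma lie_deriv_smooth_valued:
  assumes "X \<in> VF" "smooth_valued w"
  shows "smooth_valued (lie_deriv M X w)"
  unfolding smooth_valued_def
proof (intro allI impI)
  fix Ys assume "set Ys \<subseteq> VF"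
  moreover have "X (w Ys) \<in> SF"
    using assms calculation by (simp add: smooth_valued_def VF_simps)
  moreover have "(\<Sum>i<length Ys. w (Ys[i := vf_bracket X (Ys ! i)])) \<in> SF"
    using assms(2) update_subset_VF[OF calculation(1) assms(1)]
    by (intro SF_sum) (simp add: smooth_valued_def)
  ultimately show "lie_deriv M X w Ys \<in> SF"
    by (simp add: lie_deriv_def SF_diff)
qed

lemma lie_deriv_add:
  assumes "X \<in> VF" "smooth_valued u" "smooth_valued w"
  shows "lie_deriv M X (u + w) = lie_deriv M X u + lie_deriv M X w"
proof (rule eq_plusI)
  fix Ys
  show "lie_deriv M X (u + w) Ys = lie_deriv M X u Ys + lie_deriv M X w Ys"
    using assms
    by (simp add: lie_deriv_def smooth_valued_def VF_simps sum.distrib form_apply_simps)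
qed

lemma lie_deriv_scale:
  assumes "X \<in> VF" "smooth_valued w"
  shows "lie_deriv M X (c *\<^sub>R w) = c *\<^sub>R lie_deriv M X w"
proof (rule eq_scaleRI)
  fix Ys
  show "lie_deriv M X (c *\<^sub>R w) Ys = c *\<^sub>R lie_deriv M X w Ys"
    using assms
    by (simp add: form_apply_simps lie_deriv_def smooth_valued_def VF_simps scaleR_diff_right scaleR_sum_right)
qed

lemma lie_deriv_0: "X \<in> VF \<Longrightarrow> lie_deriv M X 0 = 0"
  by (simp add: fun_eq_iff[of _ 0] lie_deriv_def VF_0 form_apply_simps)

lemma smooth_valued_diff: "smooth_valued u \<Longrightarrow> smooth_valued w \<Longrightarrow> smooth_valued (u - w)"
  by (simp add: smooth_valued_def SF_diff form_apply_simps)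

lemma lie_deriv_diff:
  assumes "X \<in> VF" "smooth_valued u" "smooth_valued w"
  shows "lie_deriv M X (u - w) = lie_deriv M X u - lie_deriv M X w"
  using lie_deriv_add[OF assms(1) smooth_valued_diff[OF assms(2,3)] assms(3)] by simp

lemma lie_deriv_mult:
  assumes "X \<in> VF" "smooth_valued w" "f \<in> SF" "set Ys \<subseteq> VF"
  shows "lie_deriv M X (\<lambda>Ys. f * w Ys) Ys = X f * w Ys + f * lie_deriv M X w Ys"
  using assms
  by (simp add: lie_deriv_def smooth_valued_def VF_simps sum_distrib_left algebra_simps)

text \<open>If Y occurs once in Ys, the only surviving term has the bracket in place of that
  occurrence, and a transposition exchanges it with the leading Y. With more occurrences everything
  is 0. This makes the Lie derivative alternating.\<close>

lemma lie_deriv_not_distinct_aux: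
  assumes "X \<in> VF" "w \<in> forms M" "Y \<in> VF" "set Ys \<subseteq> VF" "Y \<in> set Ys"
  shows "lie_deriv M X (contract Y w) Ys = w (vf_bracket X Y # Ys)"
  using assms(2,4,5)
proof (induction Ys arbitrary: w)
  case (Cons Z Zs)
  have Z: "Z \<in> VF" "set Zs \<subseteq> VF" using Cons.prems by auto
  have XY: "vf_bracket X Y \<in> VF" "vf_bracket X Z \<in> VF" using assms Z by (auto intro: VF_bracket)
  have L: "lie_deriv M X (contract Y w) (Z # Zs) =
      lie_deriv M X (contract Z (contract Y w)) Zs - w (Y # vf_bracket X Z # Zs)"
    by (simp add: lie_deriv_Cons[OF Z(2,1)] contract_apply)
  show ?case
  proof (cases "Z = Y")
    case True
    have "contract Y (contract Y w) = 0"
      using forms_D(5)[OF Cons.prems(1)] by (simp add: fun_eq_iff[of _ 0] contract_apply form_apply_simps)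
    then show ?thesis
      using L True XY forms_swap[OF Cons.prems(1) assms(3) XY(1) Z(2)] assms(1)
      by (simp add: lie_deriv_0 form_apply_simps)
  next
    case False
    then have Y: "Y \<in> set Zs" using Cons.prems by auto
    \<comment> \<open>Contractions anticommute; with Y applied last, the induction hypothesis for
      \<open>contract Z w\<close> applies.\<close>
    have "contract Z (contract Y w) = - contract Y (contract Z w)"
    proof (rule eq_uminusI)
      fix Us
      show "contract Z (contract Y w) Us = - contract Y (contract Z w) Us"
        using forms_swap[OF Cons.prems(1) assms(3) Z(1), of Us] forms_D(2)[OF Cons.prems(1)]
        by (cases "set Us \<subseteq> VF") (simp_all add: contract_apply)
    qed
    then have "lie_deriv M X (contract Z (contract Y w)) Zs = - lie_deriv M X (contract Y (contract Z w)) Zs"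
      using lie_deriv_scale[OF assms(1) smooth_valued_forms[OF contract_forms[OF contract_forms[OF Cons.prems(1)]]], of "-1" Y Z]
      by (simp add: form_apply_simps)
    also have "\<dots> = - w (Z # vf_bracket X Y # Zs)"
      by (simp only: Cons.IH[OF contract_forms[OF Cons.prems(1)] Z(2) Y] contract_apply)
    also have "\<dots> = w (vf_bracket X Y # Z # Zs)"
      using forms_swap[OF Cons.prems(1) Z(1) XY(1) Z(2)] by simp
    finally show ?thesis
      using L Y forms_D(5)[OF Cons.prems(1), of "Y # vf_bracket X Z # Zs"] by simp
  qed
qed simp

lemma lie_deriv_forms:
  assumes X: "X \<in> VF" and "w \<in> forms M"
  shows "lie_deriv M X w \<in> forms M"
proof (rule forms_I)
  show "lie_deriv M X w Xs \<in> SF" if "set Xs \<subseteq> VF" for Xs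
    using lie_deriv_smooth_valued[OF X smooth_valued_forms[OF assms(2)]] that by (simp add: smooth_valued_def)
  show "lie_deriv M X w Xs = 0" if "\<not> set Xs \<subseteq> VF" for Xs
    by (rule lie_deriv_not_VF[OF that])
  show "lie_deriv M X w Xs = 0" if "set Xs \<subseteq> VF" "\<not> distinct Xs" for Xs
    using assms(2) that
  proof (induction Xs arbitrary: w)
    case (Cons Y Ys)
    have Y: "Y \<in> VF" "set Ys \<subseteq> VF" using Cons.prems by auto
    show ?case
    proof (cases "Y \<in> set Ys")
      case True
      then show ?thesis
        using lie_deriv_not_distinct_aux[OF X Cons.prems(1) Y True] by (simp add: lie_deriv_Cons[OF Y(2,1)])
    next
      case False
      then show ?thesis
        using Cons.IH[OF contract_forms[OF Cons.prems(1)] Y(2)] Cons.prems(3) forms_D(5)[OF Cons.prems(1), of "_ # Ys"]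
        by (simp add: lie_deriv_Cons[OF Y(2,1)])
    qed
  qed simp
next
  fix Us Vs A B
  assume *: "A \<in> VF" "B \<in> VF" "set Us \<subseteq> VF" "set Vs \<subseteq> VF"
  have AB: "A + B \<in> VF" using * subspace_add[OF subspace_VF] by blast
  show "lie_deriv M X w (Us @ (A + B) # Vs) = lie_deriv M X w (Us @ A # Vs) + lie_deriv M X w (Us @ B # Vs)"
    using *(3) assms(2)
  proof (induction Us arbitrary: w)
    case Nil
    have "contract (A + B) w = contract A w + contract B w"
    proof (rule eq_plusI)
      fix Zs
      show "contract (A + B) w Zs = contract A w Zs + contract B w Zs"
        using * forms_D_head(1)[OF Nil(2)] forms_D(2)[OF Nil(2)]
        by (cases "set Zs \<subseteq> VF") (simp_all add: contract_apply)
    qed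
    then show ?case
      using * AB Nil(2) X
      by (simp add: lie_deriv_Cons lie_deriv_add smooth_valued_forms contract_forms vf_bracket_add_right
          forms_D_head(1) VF_bracket)
        (simp add: form_apply_simps(1))
  next
    case (Cons U Us)
    then show ?case
      using * AB X Cons.IH[OF _ contract_forms[OF Cons.prems(2)], of U]
        forms_D(3)[OF Cons.prems(2) *(1,2), of "vf_bracket X U # Us" Vs]
      by (simp add: lie_deriv_Cons VF_bracket)
  qed
next
  fix Us Vs A f
  assume *: "A \<in> VF" "f \<in> SF" "set Us \<subseteq> VF" "set Vs \<subseteq> VF"
  have fA: "(\<lambda>g. f * A g) \<in> VF" using * by (simp add: VF_mult)
  show "lie_deriv M X w (Us @ (\<lambda>g. f * A g) # Vs) = f * lie_deriv M X w (Us @ A # Vs)"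
    using *(3) assms(2)
  proof (induction Us arbitrary: w)
    case Nil
    have eq: "contract (\<lambda>g. f * A g) w = (\<lambda>Zs. f * contract A w Zs)"
    proof
      fix Zs
      show "contract (\<lambda>g. f * A g) w Zs = f * contract A w Zs"
        using * forms_D_head(2)[OF Nil(2)] forms_D(2)[OF Nil(2)]
        by (cases "set Zs \<subseteq> VF") (simp_all add: contract_apply)
    qed
    have XA: "vf_bracket X A \<in> VF" and Xf: "X f \<in> SF"
      using X * by (auto simp: VF_bracket VF_simps)
    \<comment> \<open>The same term \<open>X f * w (A # Vs)\<close> arises from the bracket and from
      differentiating the coefficient f; the two cancel in the difference.\<close>
    have "w (vf_bracket X (\<lambda>g. f * A g) # Vs) = f * w (vf_bracket X A # Vs) + X f * w (A # Vs)"
      using * X XA Xf by (simp only: vf_bracket_mult_right forms_D_head[OF Nil(2)] VF_mult)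
    moreover have "lie_deriv M X (\<lambda>Zs. f * contract A w Zs) Vs =
        X f * w (A # Vs) + f * lie_deriv M X (contract A w) Vs"
      using lie_deriv_mult[OF X smooth_valued_forms[OF contract_forms[OF Nil(2)]] *(2,4), of A]
      by (simp only: contract_apply)
    ultimately show ?case
      by (simp add: lie_deriv_Cons[OF *(4) fA] lie_deriv_Cons[OF *(4,1)] eq right_diff_distrib)
  next
    case (Cons U Us)
    then show ?case
      using * fA X Cons.IH[OF _ contract_forms[OF Cons.prems(2)], of U]
        forms_D(4)[OF Cons.prems(2) *(1,2), of "vf_bracket X U # Us" Vs]
      by (simp add: lie_deriv_Cons VF_bracket algebra_simps)
  qed
qed

lemma contract_lie_deriv:
  assumes "X \<in> VF" "Y \<in> VF" "w \<in> forms M"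
  shows "contract Y (lie_deriv M X w) = lie_deriv M X (contract Y w) - contract (vf_bracket X Y) w"
proof (rule eq_minusI)
  fix Ys
  show "contract Y (lie_deriv M X w) Ys = lie_deriv M X (contract Y w) Ys - contract (vf_bracket X Y) w Ys"
    using assms forms_D(2)[OF assms(3)]
    by (cases "set Ys \<subseteq> VF") (simp_all add: lie_deriv_Cons lie_deriv_not_VF contract_apply)
qed

lemma contract_diff_left:
  assumes "X \<in> VF" "Y \<in> VF" "w \<in> forms M"
  shows "contract (X - Y) w = contract X w - contract Y w"
proof (rule eq_minusI)
  fix Ys
  have "X - Y \<in> VF" using assms subspace_diff[OF subspace_VF] by blast
  then show "contract (X - Y) w Ys = contract X w Ys - contract Y w Ys"
    using assms forms_D_head(1)[OF assms(3), of "X - Y" Y Ys] forms_D(2)[OF assms(3)]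
    by (cases "set Ys \<subseteq> VF") (simp_all add: contract_apply)
qed

text \<open>When contraction with the first argument is moved through both Lie derivatives, the
  mixed terms cancel and the double brackets combine by Jacobi. On the empty list the claim is the
  definition of the bracket.\<close>

lemma lie_deriv_bracket:
  assumes X: "X \<in> VF" and Y: "Y \<in> VF" and w: "w \<in> forms M"
  shows "lie_deriv M (vf_bracket X Y) w = lie_deriv M X (lie_deriv M Y w) - lie_deriv M Y (lie_deriv M X w)"
proof (rule eq_minusI)
  fix Zs
  show "lie_deriv M (vf_bracket X Y) w Zs = lie_deriv M X (lie_deriv M Y w) Zs - lie_deriv M Y (lie_deriv M X w) Zs"
  proof (cases "set Zs \<subseteq> VF")
    case True
    then show ?thesis
      using w
    proof (induction Zs arbitrary: w)
      case Nil
      then show ?case by (simp add: lie_deriv_Nil vf_bracket_def)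
    next
      case (Cons Z Zs)
      have Z: "Z \<in> VF" "set Zs \<subseteq> VF" using Cons.prems by auto
      note simps = VF_bracket X Y Z Cons.prems(2) contract_forms lie_deriv_forms smooth_valued_forms
      have "lie_deriv M X (lie_deriv M Y w) (Z # Zs) - lie_deriv M Y (lie_deriv M X w) (Z # Zs) =
          contract Z (lie_deriv M X (lie_deriv M Y w)) Zs - contract Z (lie_deriv M Y (lie_deriv M X w)) Zs"
        by (simp add: contract_apply)
      also have "\<dots> = (lie_deriv M X (lie_deriv M Y (contract Z w)) Zs - lie_deriv M Y (lie_deriv M X (contract Z w)) Zs)
          - (contract (vf_bracket X (vf_bracket Y Z)) w - contract (vf_bracket Y (vf_bracket X Z)) w) Zs"
        by (simp add: contract_lie_deriv lie_deriv_diff simps form_apply_simps)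
      also have "\<dots> = lie_deriv M (vf_bracket X Y) (contract Z w) Zs - contract (vf_bracket (vf_bracket X Y) Z) w Zs"
        by (simp only: Cons.IH[OF Z(2) contract_forms[OF Cons.prems(2)], of Z])
          (simp add: vf_jacobi contract_diff_left simps)
      finally show ?case
        using lie_deriv_Cons[OF Z(2,1), of "vf_bracket X Y" w] by (simp add: contract_apply)
    qed
  qed (simp add: lie_deriv_not_VF)
qed

lemma lie_deriv_add_field:
  assumes "X \<in> VF" "Y \<in> VF" "w \<in> forms M"
  shows "lie_deriv M (X + Y) w = lie_deriv M X w + lie_deriv M Y w"
proof (rule eq_plusI)
  fix Zs
  have XY: "X + Y \<in> VF" using assms subspace_add[OF subspace_VF] by blast
  show "lie_deriv M (X + Y) w Zs = lie_deriv M X w Zs + lie_deriv M Y w Zs"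
  proof (cases "set Zs \<subseteq> VF")
    case True
    then show ?thesis
      using assms(3)
    proof (induction Zs arbitrary: w)
      case (Cons Z Zs)
      then show ?case
        using Cons.IH[OF _ contract_forms[OF Cons.prems(2)], of Z] assms(1,2)
        by (simp add: lie_deriv_Cons vf_bracket_add_left forms_D_head(1) VF_bracket)
    qed (simp add: lie_deriv_Nil form_apply_simps)
  qed (simp add: lie_deriv_not_VF)
qed

lemma lie_deriv_scale_field:
  assumes "X \<in> VF" "w \<in> forms M"
  shows "lie_deriv M (c *\<^sub>R X) w = c *\<^sub>R lie_deriv M X w"
proof (rule eq_scaleRI)
  fix Zs
  show "lie_deriv M (c *\<^sub>R X) w Zs = c *\<^sub>R lie_deriv M X w Zs"
  proof (cases "set Zs \<subseteq> VF")
    case True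
    then show ?thesis
      using assms(2)
    proof (induction Zs arbitrary: w)
      case (Cons Z Zs)
      then show ?case
        using Cons.IH[OF _ contract_forms[OF Cons.prems(2)], of Z] assms(1)
          forms_scale_slot[OF Cons.prems(2), of "vf_bracket X Z" "[]" Zs c]
        by (simp add: lie_deriv_Cons vf_bracket_scale_left VF_bracket scaleR_diff_right)
    qed (simp add: lie_deriv_Nil form_apply_simps)
  qed (simp add: lie_deriv_not_VF)
qed

section \<open>The exterior derivative\<close>

lemma forms_move:
  "w \<in> forms M \<Longrightarrow> set Ys \<subseteq> VF \<Longrightarrow> Z \<in> VF \<Longrightarrow> i < length Ys \<Longrightarrow>
    w (Z # nths Ys (- {i})) = (-1) ^ i *\<^sub>R w (Ys[i := Z])"
proof (induction Ys arbitrary: i w)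
  case (Cons Y Ys)
  show ?case
  proof (cases i)
    case (Suc j)
    have "set (nths Ys (- {j})) \<subseteq> VF" using Cons.prems set_nths_subset by fastforce
    then show ?thesis
      using Suc Cons.prems Cons.IH[OF contract_forms[OF Cons.prems(1)], of j Y]
        forms_swap[OF Cons.prems(1), of Z Y "nths Ys (- {j})"]
      by (simp add: nths_omit contract_apply)
  qed (simp add: nths_omit)
qed simp

lemma ext_deriv_Nil: "ext_deriv M w [] = 0"
  by (simp add: ext_deriv_def)

lemma ext_deriv_not_VF: "\<not> set Ys \<subseteq> VF \<Longrightarrow> ext_deriv M w Ys = 0"
  by (simp add: ext_deriv_def)

text \<open>Cartan's formula: in the global formula for d, the terms that involve index 0 make up
  the Lie derivative, and the others are minus the terms for \<open>contract X w\<close>.\<close>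

lemma ext_deriv_Cons:
  assumes w: "w \<in> forms M" and X: "X \<in> VF" and Ys: "set Ys \<subseteq> VF"
  shows "ext_deriv M w (X # Ys) = lie_deriv M X w Ys - ext_deriv M (contract X w) Ys"
proof -
  let ?f = "\<lambda>i j. (-1) ^ (i + j) *\<^sub>R
    w (vf_bracket ((X # Ys) ! i) ((X # Ys) ! j) # nths (X # Ys) (- {i, j}))"
  let ?g = "\<lambda>i j. (-1) ^ (i + j) *\<^sub>R
    contract X w (vf_bracket (Ys ! i) (Ys ! j) # nths Ys (- {i, j}))"
  have Ys': "Ys ! i \<in> VF" if "i < length Ys" for i using Ys that by auto
  \<comment> \<open>The signs \<open>(-1) ^ Suc j\<close> and, from \<open>forms_move\<close>,
    \<open>(-1) ^ j\<close> combine to a minus, as for the boundary of a wedge.\<close>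
  have first: "?f 0 (Suc j) = - w (Ys[j := vf_bracket X (Ys ! j)])" if "j < length Ys" for j
    using forms_move[OF w Ys VF_bracket[OF X Ys'[OF that]] that] by (simp add: nths_omit)
  have rest: "?f (Suc i) (Suc j) = - ?g i j" if "i < j" "j < length Ys" for i j
  proof -
    have "set (nths Ys (- {i, j})) \<subseteq> VF" using Ys set_nths_subset by fastforce
    then show ?thesis
      using forms_swap[OF w _ X, of "vf_bracket (Ys ! i) (Ys ! j)" "nths Ys (- {i, j})"] Ys'[of i] Ys'[of j] that
      by (simp add: nths_omit VF_bracket contract_apply)
  qed
  have "(\<Sum>j<length (X # Ys). \<Sum>i<j. ?f i j) = (\<Sum>j<length Ys. ?f 0 (Suc j) + (\<Sum>i<j. ?f (Suc i) (Suc j)))"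
    by (simp add: sum.lessThan_Suc_shift del: sum.lessThan_Suc)
  also have "\<dots> = (\<Sum>j<length Ys. - w (Ys[j := vf_bracket X (Ys ! j)]) + (\<Sum>i<j. - ?g i j))"
    by (intro sum.cong refl arg_cong2[of _ _ _ _ "(+)"] first rest) auto
  also have "\<dots> = - (\<Sum>j<length Ys. w (Ys[j := vf_bracket X (Ys ! j)])) - (\<Sum>j<length Ys. \<Sum>i<j. ?g i j)"
    by (simp only: sum.distrib sum_negf) simp
  finally have brackets: "(\<Sum>j<length (X # Ys). \<Sum>i<j. ?f i j) =
      - (\<Sum>j<length Ys. w (Ys[j := vf_bracket X (Ys ! j)])) - (\<Sum>j<length Ys. \<Sum>i<j. ?g i j)" .
  have "(\<Sum>i<length (X # Ys). (-1) ^ i *\<^sub>R ((X # Ys) ! i) (w (nths (X # Ys) (- {i})))) =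
      X (w Ys) - (\<Sum>i<length Ys. (-1) ^ i *\<^sub>R (Ys ! i) (contract X w (nths Ys (- {i}))))"
    by (simp add: sum.lessThan_Suc_shift nths_omit sum_negf contract_apply del: sum.lessThan_Suc)
  then show ?thesis
    using X Ys brackets by (simp add: ext_deriv_def lie_deriv_def contract_apply)
qed

text \<open>Linearity of the Lie derivative asks only for smooth values, so this is enough for
  applying it to sums that contain exterior derivatives.\<close>

lemma ext_deriv_smooth_valued: "w \<in> forms M \<Longrightarrow> smooth_valued (ext_deriv M w)"
  unfolding smooth_valued_def
proof (intro allI impI)
  fix Ys assume "w \<in> forms M" "set Ys \<subseteq> VF"
  then show "ext_deriv M w Ys \<in> SF"
  proof (induction Ys arbitrary: w)
    case (Cons X Ys)
    then show ?case
      using Cons.IH[OF contract_forms[OF Cons.prems(1)], of X] forms_D(1)[OF lie_deriv_forms[OF _ Cons.prems(1)], of X Ys]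
      by (simp add: ext_deriv_Cons SF_diff)
  qed (simp add: ext_deriv_Nil SF_0)
qed

lemma ext_deriv_add:
  assumes "u \<in> forms M" "w \<in> forms M"
  shows "ext_deriv M (u + w) = ext_deriv M u + ext_deriv M w"
proof (rule eq_plusI)
  fix Ys
  show "ext_deriv M (u + w) Ys = ext_deriv M u Ys + ext_deriv M w Ys"
  proof (cases "set Ys \<subseteq> VF")
    case True
    then show ?thesis
      using assms
    proof (induction Ys arbitrary: u w)
      case (Cons X Ys)
      then show ?case
        using Cons.IH[OF _ contract_forms contract_forms, of u w X X]
        by (simp add: ext_deriv_Cons forms_add lie_deriv_add smooth_valued_forms)
          (simp add: form_apply_simps(1))
    qed (simp add: ext_deriv_Nil)
  qed (simp add: ext_deriv_not_VF)
qed

lemma ext_deriv_scale: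
  assumes "w \<in> forms M"
  shows "ext_deriv M (c *\<^sub>R w) = c *\<^sub>R ext_deriv M w"
proof (rule eq_scaleRI)
  fix Ys
  show "ext_deriv M (c *\<^sub>R w) Ys = c *\<^sub>R ext_deriv M w Ys"
  proof (cases "set Ys \<subseteq> VF")
    case True
    then show ?thesis
      using assms
    proof (induction Ys arbitrary: w)
      case (Cons X Ys)
      then show ?case
        using Cons.IH[OF _ contract_forms, of w X]
        by (simp add: ext_deriv_Cons forms_scale lie_deriv_scale smooth_valued_forms)
          (simp add: form_apply_simps(4) scaleR_diff_right)
    qed (simp add: ext_deriv_Nil)
  qed (simp add: ext_deriv_not_VF)
qed

lemma ext_deriv_0: "ext_deriv M 0 = 0"
  using ext_deriv_scale[OF forms_0, of 0] by simp

lemma ext_deriv_diff: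
  assumes "u \<in> forms M" "w \<in> forms M"
  shows "ext_deriv M (u - w) = ext_deriv M u - ext_deriv M w"
  using ext_deriv_add[OF forms_diff[OF assms] assms(2)] by simp

lemma contract_ext_deriv:
  assumes "X \<in> VF" "w \<in> forms M"
  shows "contract X (ext_deriv M w) = lie_deriv M X w - ext_deriv M (contract X w)"
proof (rule eq_minusI)
  fix Ys
  show "contract X (ext_deriv M w) Ys = lie_deriv M X w Ys - ext_deriv M (contract X w) Ys"
    using assms
    by (cases "set Ys \<subseteq> VF") (simp_all add: ext_deriv_Cons lie_deriv_not_VF ext_deriv_not_VF contract_apply)
qed

text \<open>Contracting both sides with Y and expanding by Cartan's formula leaves
  \<open>lie_deriv_bracket\<close> and the claim for \<open>contract Y w\<close>.\<close>

lemma ext_deriv_lie_deriv: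
  assumes X: "X \<in> VF" and w: "w \<in> forms M"
  shows "ext_deriv M (lie_deriv M X w) = lie_deriv M X (ext_deriv M w)"
proof
  fix Ys
  show "ext_deriv M (lie_deriv M X w) Ys = lie_deriv M X (ext_deriv M w) Ys"
  proof (cases "set Ys \<subseteq> VF")
    case True
    then show ?thesis
      using w
    proof (induction Ys arbitrary: w)
      case Nil
      then show ?case using X by (simp add: ext_deriv_Nil lie_deriv_Nil VF_0)
    next
      case (Cons Y Ys)
      have Y: "Y \<in> VF" "set Ys \<subseteq> VF" using Cons.prems by auto
      note simps = VF_bracket X Y Cons.prems(2) contract_forms lie_deriv_forms smooth_valued_forms
        ext_deriv_smooth_valued
      have "lie_deriv M X (ext_deriv M w) (Y # Ys) =
          lie_deriv M X (contract Y (ext_deriv M w)) Ys - contract (vf_bracket X Y) (ext_deriv M w) Ys"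
        by (simp add: lie_deriv_Cons[OF Y(2,1)] contract_apply)
      also have "\<dots> = (lie_deriv M X (lie_deriv M Y w) - lie_deriv M X (ext_deriv M (contract Y w))
          - lie_deriv M (vf_bracket X Y) w + ext_deriv M (contract (vf_bracket X Y) w)) Ys"
        by (simp add: contract_ext_deriv lie_deriv_diff simps form_apply_simps)
      also have "\<dots> = (lie_deriv M Y (lie_deriv M X w) - ext_deriv M (lie_deriv M X (contract Y w))
          + ext_deriv M (contract (vf_bracket X Y) w)) Ys"
        using Cons.IH[OF Y(2) contract_forms[OF Cons.prems(2)], of Y]
        by (simp add: lie_deriv_bracket simps form_apply_simps)
      also have "\<dots> = ext_deriv M (lie_deriv M X w) (Y # Ys)"
        by (simp add: ext_deriv_Cons contract_lie_deriv ext_deriv_diff simps form_apply_simps)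
      finally show ?case by simp
    qed
  qed (simp add: ext_deriv_not_VF lie_deriv_not_VF)
qed

end

section \<open>Cochains of degree 0 and 1\<close>

lemma lin_ext_of_linear:
  assumes "\<And>k p q. p \<in> ext_power k \<Longrightarrow> q \<in> ext_power k \<Longrightarrow> G k (p + q) = G k p + G k q"
    and "\<And>k p c. p \<in> ext_power k \<Longrightarrow> G k (c *\<^sub>R p) = c *\<^sub>R G k p"
  shows "linear (lin_ext (\<lambda>xs. G (length xs) (wedge xs)))"
    and "p \<in> ext_power k \<Longrightarrow> lin_ext (\<lambda>xs. G (length xs) (wedge xs)) p = G k p"
proof -
  note am = alternating_multilinear_of_linear[of G, OF assms]
  show lin: "linear (lin_ext (\<lambda>xs. G (length xs) (wedge xs)))"
    by (rule linear_lin_ext[OF am])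
  show "lin_ext (\<lambda>xs. G (length xs) (wedge xs)) p = G k p" if "p \<in> ext_power k"
    using that
  proof (induction rule: ext_power_induct)
    case (wedge xs)
    then show ?case by (simp add: lin_ext_wedge[OF am])
  next
    case zero
    then show ?case
      using assms(2)[OF subspace_0[OF subspace_ext_power], of k 0] by (simp add: linear_0[OF lin])
  qed (simp_all add: linear_add[OF lin] linear_scale[OF lin] assms)
qed

lemma alternating_multilinear_CE_const: "alternating_multilinear (\<lambda>xs. if xs = [] then w else 0)"
  by (rule alternating_multilinearI) simp_all

lemma linear_CE_const: "linear (CE_const w)"
  and CE_const_wedge: "CE_const w (wedge xs) = (if xs = [] then w else 0)"
  unfolding CE_const_def
  by (rule linear_lin_ext lin_ext_wedge, rule alternating_multilinear_CE_const)+

lemma CE_const_ext_power: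
  assumes "p \<in> ext_power k" "k \<noteq> 0"
  shows "CE_const w p = 0"
proof -
  have "CE_const w p \<in> {0}"
    by (rule linear_image_ext_power[OF linear_CE_const subspace_single_0 _ assms(1)])
      (use assms(2) in \<open>auto simp: CE_const_wedge\<close>)
  then show ?thesis by simp
qed

lemma CE_const_cochain: "subspace W \<Longrightarrow> w \<in> W \<Longrightarrow> CE_const w \<in> CE_cochains W 0"
  using linear_image_ext_power[OF linear_CE_const, of W 0 w]
  by (auto simp: CE_cochains_def linear_CE_const CE_const_ext_power CE_const_wedge)

lemma CE_cochain_0_eq_const: "c \<in> CE_cochains W 0 \<Longrightarrow> c = CE_const (c (wedge []))"
proof
  fix p assume c: "c \<in> CE_cochains W 0"
  show "c p = CE_const (c (wedge [])) p"
  proof (rule linear_eq_on_wedge[OF _ linear_CE_const])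
    show "linear c" using c by (simp add: CE_cochains_def)
    show "c (wedge xs) = CE_const (c (wedge [])) (wedge xs)" for xs
      using c wedge_in_ext_power[of xs] by (auto simp: CE_cochains_def CE_const_wedge)
  qed
qed

context lie_alg
begin

text \<open>Only lists of length 1 contribute. \<delta> vanishes in degrees 0 and 1; from length 2
  on, both \<delta> and the omission of an entry leave positive degree, where the constant cochain
  is 0.\<close>

lemma CE_diff_const:
  assumes "\<And>x. act x 0 = 0" and lin: "linear (\<lambda>x. act x w)"
  shows linear_CE_diff_const: "linear (CE_diff br act (CE_const w))"
    and CE_diff_const_wedge: "CE_diff br act (CE_const w) (wedge xs) = (case xs of [x] \<Rightarrow> act x w | _ \<Rightarrow> 0)"
proof -
  let ?F = "\<lambda>xs. case xs of [x] \<Rightarrow> act x w | _ \<Rightarrow> 0"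
  have "CE_const w (delta br (wedge xs)) + (\<Sum>i<length xs. (-1) ^ i *\<^sub>R act (xs ! i) (CE_const w (wedge (nths xs (- {i}))))) = ?F xs"
    for xs
  proof (cases "length xs \<le> 1")
    case True
    then show ?thesis
      using delta_ext_power_1[OF wedge_in_ext_power True] linear_0[OF linear_CE_const]
      by (cases xs) (simp_all add: nths_omit CE_const_wedge)
  next
    case False
    then have "CE_const w (delta br (wedge xs)) = 0"
      by (intro CE_const_ext_power[OF delta_in_ext_power[OF wedge_in_ext_power]]) simp
    moreover have "nths xs (- {i}) \<noteq> []" if "i < length xs" for i
      using False length_nths_omit[OF that] by auto
    moreover have "?F xs = 0" using False by (auto split: list.split)
    ultimately show ?thesis
      by (simp add: CE_const_wedge assms(1))
  qed
  then have eq: "CE_diff br act (CE_const w) = lin_ext ?F"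
    by (simp only: CE_diff_def)
  have am: "alternating_multilinear ?F"
  proof (rule alternating_multilinearI)
    fix us vs x y c
    show "?F (us @ [x + y] @ vs) = ?F (us @ [x] @ vs) + ?F (us @ [y] @ vs)"
      by (cases us; cases vs) (auto simp: linear_add[OF lin] split: list.split)
    show "?F (us @ [c *\<^sub>R x] @ vs) = c *\<^sub>R ?F (us @ [x] @ vs)"
      by (cases us; cases vs) (auto simp: linear_scale[OF lin] split: list.split)
    show "?F (us @ [x, x] @ vs) = 0"
      by (cases us) (auto split: list.split)
  qed
  show "linear (CE_diff br act (CE_const w))" "CE_diff br act (CE_const w) (wedge xs) = ?F xs"
    using lin_ext[OF am] by (simp_all only: eq)
qed

text \<open>For reasons of degree only lists of length 2 matter. There
  \<open>\<delta>(x \<and> y) = - [x, y]\<close>, and the last assumption is the cocycle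
  identity.\<close>

lemma CE_diff_1_eq_0:
  assumes "\<And>x. act x 0 = 0" "linear c" "\<And>j p. j \<noteq> 1 \<Longrightarrow> p \<in> ext_power j \<Longrightarrow> c p = 0"
    and "\<And>x y. c (wedge [br x y]) = act x (c (wedge [y])) - act y (c (wedge [x]))"
  shows "CE_diff br act c = 0"
proof -
  have zero: "c (wedge xs) = 0" if "length xs \<noteq> 1" for xs
    using assms(3)[OF that wedge_in_ext_power] .
  have "c (delta br (wedge xs)) + (\<Sum>i<length xs. (-1) ^ i *\<^sub>R act (xs ! i) (c (wedge (nths xs (- {i}))))) = 0" for xs
  proof (cases "length xs = 2")
    case True
    then obtain x y where "xs = [x, y]" by (auto simp: length_Suc_conv numeral_2_eq_2)
    then show ?thesis
      using assms(4)[of x y]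
      by (simp add: delta_wedge left_wedge_linear_simps linear_neg[OF assms(2)] nths_omit)
  next
    case False
    have "c (delta br (wedge xs)) = 0"
    proof (cases "length xs \<le> 1")
      case True
      then show ?thesis
        using delta_ext_power_1[OF wedge_in_ext_power True] linear_0[OF assms(2)] by simp
    next
      case 2: False
      then show ?thesis
        using False by (intro assms(3)[OF _ delta_in_ext_power[OF wedge_in_ext_power]]) linarith
    qed
    moreover have "c (wedge (nths xs (- {i}))) = 0" if "i < length xs" for i
      using False length_nths_omit[OF that] by (intro zero) auto
    ultimately show ?thesis by (simp add: assms(1))
  qed
  then have "CE_diff br act c = lin_ext (\<lambda>_. 0)"
    by (simp only: CE_diff_def)
  also have "\<dots> = (\<lambda>_. 0)"
    by (rule lin_ext_eqI[OF linear_zero]) simp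
  finally show ?thesis by (simp add: zero_fun_def)
qed

end

text \<open>Closure of the coboundaries under subtraction is an assumption because
  \<open>CE_diff\<close> is a linear extension, whose additivity in the cochain has to be
  established for the cochains at hand.\<close>

lemma CE_class_eq_0_iff:
  assumes "0 \<in> CE_coboundaries br act W k"
    and diff: "\<And>a b. a \<in> CE_coboundaries br act W k \<Longrightarrow> b \<in> CE_coboundaries br act W k \<Longrightarrow>
      a - b \<in> CE_coboundaries br act W k"
    and "0 \<in> CE_cocycles br act W k" "D \<in> CE_cocycles br act W k"
  shows "CE_class br act W k D = CE_class br act W k 0 \<longleftrightarrow> D \<in> CE_coboundaries br act W k"
    (is "_ \<longleftrightarrow> _ \<in> ?B")
proof
  assume "CE_class br act W k D = CE_class br act W k 0"
  moreover have "0 \<in> CE_class br act W k 0"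
    using assms by (simp add: CE_class_def cohomologous_def)
  ultimately have "0 \<in> CE_class br act W k D" by simp
  then show "D \<in> ?B" by (simp add: CE_class_def cohomologous_def)
next
  assume D: "D \<in> ?B"
  have "D - b \<in> ?B \<longleftrightarrow> 0 - b \<in> ?B" for b
    using diff[OF _ D, of "D - b"] diff[OF D, of b] diff[OF assms(1), of "0 - b"] by auto
  then show "CE_class br act W k D = CE_class br act W k 0"
    using assms(3,4) by (auto simp: CE_class_def cohomologous_def)
qed

section \<open>The total complex\<close>

text \<open>The projection of \<Omega>(M) onto degree m, needed because the values of closed
  elements and potentials may mix degrees.\<close>

definition form_part :: "nat \<Rightarrow> 'm form \<Rightarrow> 'm form"
  where "form_part m w = (\<lambda>Ys. if length Ys = m then w Ys else 0)"

lemma form_part_linear_simps: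
  "form_part m (u + w) = form_part m u + form_part m w"
  "form_part m (u - w) = form_part m u - form_part m w"
  "form_part m (c *\<^sub>R w) = c *\<^sub>R form_part m w"
  "form_part m 0 = 0"
  by (auto simp: form_part_def fun_eq_iff fun_apply_simps)

context smooth_mfd
begin

lemma form_part_forms_deg: "w \<in> forms M \<Longrightarrow> form_part m w \<in> forms_deg M m"
proof -
  assume w: "w \<in> forms M"
  have "form_part m w \<in> forms M"
    by (rule forms_I) (simp_all add: form_part_def forms_D[OF w] SF_0)
  then show ?thesis by (simp add: forms_deg_def form_part_def)
qed

lemma lie_deriv_form_part: "X \<in> VF \<Longrightarrow> lie_deriv M X (form_part m w) = form_part m (lie_deriv M X w)"
  by (rule HOL.ext) (simp add: lie_deriv_def form_part_def VF_0)

lemma ext_deriv_form_part: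
  assumes "w \<in> forms M"
  shows "ext_deriv M (form_part m w) = form_part (Suc m) (ext_deriv M w)"
proof
  fix Ys
  show "ext_deriv M (form_part m w) Ys = form_part (Suc m) (ext_deriv M w) Ys"
  proof (cases "set Ys \<subseteq> VF")
    case True
    then show ?thesis
      using assms
    proof (induction Ys arbitrary: m w)
      case Nil
      then show ?case by (simp add: ext_deriv_Nil form_part_def)
    next
      case (Cons X Ys)
      have X: "X \<in> VF" "set Ys \<subseteq> VF" using Cons.prems by auto
      have part: "form_part m w \<in> forms M"
        using form_part_forms_deg[OF Cons.prems(2)] by (simp add: forms_deg_def)
      have "ext_deriv M (form_part m w) (X # Ys) =
          form_part m (lie_deriv M X w) Ys - ext_deriv M (contract X (form_part m w)) Ys"
        by (simp only: ext_deriv_Cons[OF part X] lie_deriv_form_part[OF X(1)])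
      moreover have "ext_deriv M (contract X (form_part m w)) Ys = form_part m (ext_deriv M (contract X w)) Ys"
      proof (cases m)
        \<comment> \<open>Contraction kills a part of degree 0, and the other side is 0 because an
          exterior derivative has no component of degree 0.\<close>
        case 0
        then have "contract X (form_part m w) = 0"
          by (simp add: contract_def form_part_def zero_fun_def)
        with 0 show ?thesis by (simp add: ext_deriv_0 form_part_def ext_deriv_Nil form_apply_simps)
      next
        case (Suc j)
        then have "contract X (form_part m w) = form_part j (contract X w)"
          by (simp add: contract_def form_part_def)
        with Suc show ?thesis
          using Cons.IH[OF X(2) contract_forms[OF Cons.prems(2)]] by simp
      qed
      ultimately show ?case
        by (simp add: form_part_def ext_deriv_Cons[OF Cons.prems(2) X])
    qed
  qed (simp add: ext_deriv_not_VF form_part_def)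
qed

end

text \<open>The exponents are triangular numbers, and consecutive ones differ by k + 1. The factor
  is the Koszul sign of \<open>d_tot\<close> in degree k + 1.\<close>

lemma zeta_Suc: "zeta (Suc k) = (-1) ^ Suc k * zeta k"
proof -
  have "Suc k * (Suc k + 1) div 2 = k * (k + 1) div 2 + Suc k"
    by (simp add: algebra_simps)
  then show ?thesis by (simp only: zeta_def power_add) simp
qed

lemma zeta_square: "zeta k * zeta k = 1"
  by (simp add: zeta_def flip: power_add)

lemma (in smooth_mfd) smooth_valued_scale: "smooth_valued w \<Longrightarrow> smooth_valued (c *\<^sub>R w)"
  by (simp add: smooth_valued_def SF_scale form_apply_simps)

section \<open>The Lie algebra action on the total complex\<close>

locale lie_action_mfd = smooth_mfd M + lie_alg br
  for M :: "'m::{t2_space, second_countable_topology} manifold"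
    and br :: "'g::real_vector \<Rightarrow> 'g \<Rightarrow> 'g" +
  fixes v :: "'g \<Rightarrow> 'm vf"
  assumes action: "lie_action M br v"
begin

abbreviation "L x \<equiv> lie_deriv M (v x)"
abbreviation "act \<equiv> C_act M br v"

lemma v_simps: "v (x + y) = v x + v y" "v (c *\<^sub>R x) = c *\<^sub>R v x"
  "v x \<in> VF" "v (br x y) = vf_bracket (v x) (v y)"
  using action by (auto simp: lie_action_def linear_add linear_scale)

lemma L_forms_simps:
  assumes "w \<in> forms M"
  shows "L x w \<in> forms M" "L x (c *\<^sub>R w) = c *\<^sub>R L x w"
    "u \<in> forms M \<Longrightarrow> L x (u + w) = L x u + L x w" "u \<in> forms M \<Longrightarrow> L x (u - w) = L x u - L x w"
  using assms by (simp_all add: lie_deriv_forms lie_deriv_add lie_deriv_diff lie_deriv_scale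
    v_simps smooth_valued_forms)

lemma C_tildeD:
  assumes "\<eta> \<in> C_tilde M"
  shows "linear \<eta>" "\<eta> p \<in> forms M" "q \<in> ext_power 0 \<Longrightarrow> \<eta> q = 0"
  using assms by (auto simp: C_tilde_def)

lemma subspace_C_tilde: "subspace (C_tilde M :: ('g ext \<Rightarrow> 'm form) set)"
proof (rule subspaceI)
  have zero: "(\<lambda>p :: 'g ext. 0 :: 'm form) \<in> C_tilde M"
    by (auto simp: C_tilde_def forms_0 linear_zero)
  have eq: "0 = (\<lambda>p :: 'g ext. 0 :: 'm form)"
    by (rule HOL.ext) (rule zero_fun_apply)
  show "0 \<in> (C_tilde M :: ('g ext \<Rightarrow> 'm form) set)"
    by (subst eq) (rule zero)
  fix \<eta> \<theta> :: "'g ext \<Rightarrow> 'm form" and c :: real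
  assume \<eta>: "\<eta> \<in> C_tilde M" and \<theta>: "\<theta> \<in> C_tilde M"
  have "linear (\<lambda>p. \<eta> p + \<theta> p)" "linear (\<lambda>p. c *\<^sub>R \<eta> p)"
    by (rule linear_compose_add linear_compose_scale_right C_tildeD(1) \<eta> \<theta>)+
  moreover have "\<eta> + \<theta> = (\<lambda>p. \<eta> p + \<theta> p)" "c *\<^sub>R \<eta> = (\<lambda>p. c *\<^sub>R \<eta> p)"
    by (simp_all add: plus_fun_def scaleR_fun_def)
  ultimately show "\<eta> + \<theta> \<in> C_tilde M" "c *\<^sub>R \<eta> \<in> C_tilde M"
    by (simp_all add: C_tilde_def image_subset_iff forms_add forms_scale C_tildeD[OF \<eta>] C_tildeD[OF \<theta>])
qed

lemma d_tot:
  assumes "\<eta> \<in> C_tilde M"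
  shows linear_d_tot: "linear (d_tot M br \<eta>)"
    and d_tot_ext_power: "p \<in> ext_power k \<Longrightarrow>
      d_tot M br \<eta> p = \<eta> (delta br p) + (-1) ^ k *\<^sub>R ext_deriv M (\<eta> p)"
proof -
  let ?G = "\<lambda>k p. \<eta> (delta br p) + (-1) ^ k *\<^sub>R ext_deriv M (\<eta> p)"
  note simps = linear_add[OF C_tildeD(1)[OF assms]] linear_scale[OF C_tildeD(1)[OF assms]]
    delta_linear_simps ext_deriv_add ext_deriv_scale C_tildeD(2)[OF assms]
  have "?G k (p + q) = ?G k p + ?G k q" "?G k (c *\<^sub>R p) = c *\<^sub>R ?G k p" for k p q c
    by (simp_all add: simps algebra_simps)
  note G = lin_ext_of_linear[where G = ?G, OF this]
  show "linear (d_tot M br \<eta>)" unfolding d_tot_def by (rule G(1))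
  show "d_tot M br \<eta> p = ?G k p" if "p \<in> ext_power k" unfolding d_tot_def by (rule G(2)[OF that])
qed

lemma d_tot_diff:
  assumes "\<eta> \<in> C_tilde M" "\<theta> \<in> C_tilde M"
  shows "d_tot M br (\<eta> - \<theta>) = d_tot M br \<eta> - d_tot M br \<theta>"
proof (rule eq_minusI)
  fix p
  have diff: "\<eta> - \<theta> \<in> C_tilde M" by (rule subspace_diff[OF subspace_C_tilde assms])
  show "d_tot M br (\<eta> - \<theta>) p = d_tot M br \<eta> p - d_tot M br \<theta> p"
  proof (rule linear_eq_on_wedge[where f = "d_tot M br (\<eta> - \<theta>)" and g = "\<lambda>p. d_tot M br \<eta> p - d_tot M br \<theta> p"])
    fix xs
    show "d_tot M br (\<eta> - \<theta>) (wedge xs) = d_tot M br \<eta> (wedge xs) - d_tot M br \<theta> (wedge xs)"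
      by (simp add: d_tot_ext_power[OF _ wedge_in_ext_power] diff assms minus_apply ext_deriv_diff
          C_tildeD(2)[OF assms(1)] C_tildeD(2)[OF assms(2)] scaleR_diff_right)
  qed (auto intro!: linear_compose_sub linear_d_tot assms diff)
qed

lemma d_tot_scale:
  assumes "\<eta> \<in> C_tilde M"
  shows "d_tot M br (c *\<^sub>R \<eta>) = c *\<^sub>R d_tot M br \<eta>"
proof (rule eq_scaleRI)
  fix p
  have scale: "c *\<^sub>R \<eta> \<in> C_tilde M" by (rule subspace_scale[OF subspace_C_tilde assms])
  show "d_tot M br (c *\<^sub>R \<eta>) p = c *\<^sub>R d_tot M br \<eta> p"
  proof (rule linear_eq_on_wedge[where f = "d_tot M br (c *\<^sub>R \<eta>)" and g = "\<lambda>p. c *\<^sub>R d_tot M br \<eta> p"])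
    fix xs
    show "d_tot M br (c *\<^sub>R \<eta>) (wedge xs) = c *\<^sub>R d_tot M br \<eta> (wedge xs)"
      by (simp add: d_tot_ext_power[OF _ wedge_in_ext_power] scale assms scaleR_fun_apply ext_deriv_scale
          C_tildeD(2)[OF assms] scaleR_add_right)
  qed (auto intro!: linear_compose_scale_right linear_d_tot assms scale)
qed

lemma subspace_closed_elements: "subspace (closed_elements M br)"
proof -
  have diff: "a - b \<in> closed_elements M br" and scale: "c *\<^sub>R a \<in> closed_elements M br"
    if "a \<in> closed_elements M br" "b \<in> closed_elements M br" for a b c
    using that by (auto simp: closed_elements_def d_tot_diff d_tot_scale subspace_diff[OF subspace_C_tilde]
        subspace_scale[OF subspace_C_tilde])
  have zero: "0 \<in> closed_elements M br"
    using d_tot_scale[OF subspace_0[OF subspace_C_tilde], of 0]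
    by (simp add: closed_elements_def subspace_0[OF subspace_C_tilde])
  show ?thesis
  proof (rule subspaceI)
    fix a b assume a: "a \<in> closed_elements M br" and b: "b \<in> closed_elements M br"
    show "a + b \<in> closed_elements M br"
      using diff[OF a scale[OF b b, of "-1"]] by simp
  qed (auto intro: zero scale)
qed

lemma act_C_tilde:
  assumes "\<eta> \<in> C_tilde M"
  shows "act x \<eta> \<in> C_tilde M"
proof -
  note \<eta> = C_tildeD[OF assms]
  have "linear (act x \<eta>)"
    by (rule linearI)
      (simp_all add: C_act_def linear_add[OF \<eta>(1)] linear_scale[OF \<eta>(1)] ad_ext_linear_simps
        L_forms_simps \<eta>(2) scaleR_diff_right)
  moreover have "act x \<eta> p \<in> forms M" for p
    by (simp add: C_act_def forms_diff L_forms_simps(1) \<eta>(2))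
  moreover have "act x \<eta> p = 0" if "p \<in> ext_power 0" for p
    using that ad_ext_in_ext_power[OF that] by (simp add: C_act_def \<eta>(3) lie_deriv_0 v_simps)
  ultimately show ?thesis by (auto simp: C_tilde_def)
qed

lemma act_linear_simps:
  assumes "\<eta> \<in> C_tilde M"
  shows "act x (c *\<^sub>R \<eta>) = c *\<^sub>R act x \<eta>"
    "\<theta> \<in> C_tilde M \<Longrightarrow> act x (\<eta> + \<theta>) = act x \<eta> + act x \<theta>"
    "\<theta> \<in> C_tilde M \<Longrightarrow> act x (\<eta> - \<theta>) = act x \<eta> - act x \<theta>"
  by (rule eq_plusI eq_minusI eq_scaleRI,
      simp add: C_act_def fun_apply_simps L_forms_simps C_tildeD(2)[OF assms] C_tildeD(2) scaleR_diff_right)+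

lemma act_0: "act x 0 = 0"
  using act_linear_simps(1)[OF subspace_0[OF subspace_C_tilde], of x 0] by simp

lemma linear_act:
  assumes "\<eta> \<in> C_tilde M"
  shows "linear (\<lambda>x. act x \<eta>)"
  by (rule linearI; rule eq_plusI eq_scaleRI)
    (simp_all add: C_act_def v_simps lie_deriv_add_field lie_deriv_scale_field C_tildeD(2)[OF assms]
      ad_ext_add ad_ext_scale linear_add[OF C_tildeD(1)[OF assms]] linear_scale[OF C_tildeD(1)[OF assms]]
      scaleR_diff_right)

lemma act_br:
  assumes "\<eta> \<in> C_tilde M"
  shows "act (br x y) \<eta> = act x (act y \<eta>) - act y (act x \<eta>)"
  by (rule eq_minusI)
    (simp add: C_act_def v_simps lie_deriv_bracket C_tildeD(2)[OF assms] L_forms_simps forms_diff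
      ad_ext_br linear_diff[OF C_tildeD(1)[OF assms]])

text \<open>L commutes with d, ad commutes with \<delta>, and ad keeps the exterior power, so all
  terms carry the same Koszul sign. The right-hand side is the action on
  \<open>d_tot M br \<eta>\<close> written out.\<close>

lemma d_tot_act:
  assumes "\<eta> \<in> C_tilde M"
  shows "d_tot M br (act x \<eta>) (wedge xs) = L x (d_tot M br \<eta> (wedge xs)) - d_tot M br \<eta> (ad_ext br x (wedge xs))"
proof -
  let ?p = "wedge xs" and ?k = "length xs"
  note \<eta> = C_tildeD[OF assms]
  have "L x (d_tot M br \<eta> ?p) = L x (\<eta> (delta br ?p)) + (-1) ^ ?k *\<^sub>R L x (ext_deriv M (\<eta> ?p))"
    using ext_deriv_smooth_valued[OF \<eta>(2)]
    by (simp add: d_tot_ext_power[OF assms wedge_in_ext_power] lie_deriv_add lie_deriv_scale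
        v_simps smooth_valued_forms \<eta>(2) smooth_valued_scale)
  moreover have "d_tot M br \<eta> (ad_ext br x ?p) =
      \<eta> (ad_ext br x (delta br ?p)) + (-1) ^ ?k *\<^sub>R ext_deriv M (\<eta> (ad_ext br x ?p))"
    by (simp add: d_tot_ext_power[OF assms ad_ext_in_ext_power[OF wedge_in_ext_power]] delta_ad_ext)
  moreover have "d_tot M br (act x \<eta>) ?p = act x \<eta> (delta br ?p) + (-1) ^ ?k *\<^sub>R ext_deriv M (act x \<eta> ?p)"
    by (rule d_tot_ext_power[OF act_C_tilde[OF assms] wedge_in_ext_power])
  moreover have "ext_deriv M (act x \<eta> ?p) = L x (ext_deriv M (\<eta> ?p)) - ext_deriv M (\<eta> (ad_ext br x ?p))"
    by (simp add: C_act_def ext_deriv_diff ext_deriv_lie_deriv v_simps \<eta>(2) L_forms_simps(1))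
  moreover have "act x \<eta> (delta br ?p) = L x (\<eta> (delta br ?p)) - \<eta> (ad_ext br x (delta br ?p))"
    by (simp add: C_act_def)
  ultimately show ?thesis
    by (simp add: scaleR_diff_right)
qed

text \<open>Serves twice: for closed elements, whose differential is 0, and for a potential of
  \<open>omega_tilde\<close>, whose differential is invariant.\<close>

lemma d_tot_act_eq_0:
  assumes "\<eta> \<in> C_tilde M" "\<And>xs. L x (d_tot M br \<eta> (wedge xs)) = d_tot M br \<eta> (ad_ext br x (wedge xs))"
  shows "d_tot M br (act x \<eta>) = 0"
proof
  fix p
  show "d_tot M br (act x \<eta>) p = 0 p"
    by (rule linear_eq_on_wedge[where f = "d_tot M br (act x \<eta>)" and g = "0"])
      (simp_all add: linear_d_tot act_C_tilde assms d_tot_act C_tildeD(1)[OF subspace_0[OF subspace_C_tilde]] zero_fun_apply)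
qed

lemma lie_module_closed_elements: "lie_module br act (closed_elements M br)"
proof -
  have C: "\<eta> \<in> C_tilde M" if "\<eta> \<in> closed_elements M br" for \<eta>
    using that by (simp add: closed_elements_def)
  have "act x \<eta> \<in> closed_elements M br" if "\<eta> \<in> closed_elements M br" for x \<eta>
    using that
    by (auto simp: closed_elements_def act_C_tilde lie_deriv_0 v_simps zero_fun_apply intro!: d_tot_act_eq_0)
  then show ?thesis
    by (auto simp: lie_module_def subspace_closed_elements C act_linear_simps linear_act act_br)
qed

section \<open>Contraction along the action and invariance of omega tilde\<close>

lemma fold_contract: "fold (\<lambda>x. contract (v x)) xs w = (\<lambda>Ys. w (map v xs @ Ys))"
  by (induction xs arbitrary: w) (simp_all add: contract_def)

lemma fold_contract_forms: "w \<in> forms M \<Longrightarrow> fold (\<lambda>x. contract (v x)) xs w \<in> forms M"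
  by (induction xs arbitrary: w) (simp_all add: contract_forms)

lemma alternating_multilinear_contract:
  assumes w: "w \<in> forms M"
  shows "alternating_multilinear (\<lambda>xs. fold (\<lambda>x. contract (v x)) xs w)"
proof (rule alternating_multilinearI)
  have sub: "set (map v xs) \<subseteq> VF" for xs by (auto simp: v_simps)
  fix us vs x y and c :: real
  show "fold (\<lambda>x. contract (v x)) (us @ [x + y] @ vs) w =
      fold (\<lambda>x. contract (v x)) (us @ [x] @ vs) w + fold (\<lambda>x. contract (v x)) (us @ [y] @ vs) w"
  proof (rule eq_plusI)
    fix Ys
    show "fold (\<lambda>x. contract (v x)) (us @ [x + y] @ vs) w Ys =
        fold (\<lambda>x. contract (v x)) (us @ [x] @ vs) w Ys + fold (\<lambda>x. contract (v x)) (us @ [y] @ vs) w Ys"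
      using forms_D(3)[OF w, of "v x" "v y" "map v us" "map v vs @ Ys"] sub[of us] sub[of vs]
        forms_D(2)[OF w, of "map v us @ _ # map v vs @ Ys"]
      by (cases "set Ys \<subseteq> VF") (simp_all add: fold_contract contract_apply v_simps)
  qed
  show "fold (\<lambda>x. contract (v x)) (us @ [c *\<^sub>R x] @ vs) w = c *\<^sub>R fold (\<lambda>x. contract (v x)) (us @ [x] @ vs) w"
  proof (rule eq_scaleRI)
    fix Ys
    show "fold (\<lambda>x. contract (v x)) (us @ [c *\<^sub>R x] @ vs) w Ys =
        c *\<^sub>R fold (\<lambda>x. contract (v x)) (us @ [x] @ vs) w Ys"
      using forms_scale_slot[OF w, of "v x" "map v us" "map v vs @ Ys" c] sub[of us] sub[of vs]
        forms_D(2)[OF w, of "map v us @ _ # map v vs @ Ys"]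
      by (cases "set Ys \<subseteq> VF") (simp_all add: fold_contract contract_apply v_simps)
  qed
  show "fold (\<lambda>x. contract (v x)) (us @ [x, x] @ vs) w = 0"
    by (simp add: fun_eq_iff[of _ 0] fold_contract contract_apply forms_D(5)[OF w] zero_fun_apply)
qed

lemma contract_ext:
  assumes "w \<in> forms M"
  shows linear_contract_ext: "linear (contract_ext v w)"
    and contract_ext_wedge: "contract_ext v w (wedge xs) = fold (\<lambda>x. contract (v x)) xs w"
  using lin_ext[OF alternating_multilinear_contract[OF assms]] by (simp_all add: contract_ext_def)

lemma contract_ext_forms:
  assumes "w \<in> forms M"
  shows "contract_ext v w p \<in> forms M"
proof -
  have "contract_ext v w p \<in> span (contract_ext v w ` range wedge)"
    using ext_in_span_wedge[of p] by (simp add: linear_span_image[OF linear_contract_ext[OF assms]])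
  moreover have "contract_ext v w ` range wedge \<subseteq> forms M"
    by (auto simp: contract_ext_wedge assms fold_contract_forms)
  ultimately show ?thesis
    using span_minimal[OF _ subspace_forms] by blast
qed

text \<open>The bound \<open>k \<le> m\<close> keeps the natural subtraction honest: k fields and
  \<open>m - k\<close> further arguments make up the m arguments of w.\<close>

lemma form_part_contract_ext:
  assumes "w \<in> forms_deg M m" "p \<in> ext_power k" "k \<le> m"
  shows "form_part (m - k) (contract_ext v w p) = contract_ext v w p"
  using assms(2)
proof (induction rule: ext_power_induct)
  have w: "w \<in> forms M" using assms(1) by (simp add: forms_deg_def)
  case (wedge xs)
  then show ?case
    using assms(1,3)
    by (auto simp: contract_ext_wedge[OF w] fold_contract form_part_def forms_deg_def fun_eq_iff zero_fun_apply)
next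
  have w: "w \<in> forms M" using assms(1) by (simp add: forms_deg_def)
  { case zero
    show ?case by (simp add: linear_0[OF linear_contract_ext[OF w]] form_part_linear_simps)
  next
    case (add p q)
    then show ?case by (simp add: linear_add[OF linear_contract_ext[OF w]] form_part_linear_simps)
  next
    case (scale c p)
    then show ?case by (simp add: linear_scale[OF linear_contract_ext[OF w]] form_part_linear_simps)
  }
qed

lemma contract_ext_left_wedge:
  assumes "w \<in> forms M"
  shows "contract_ext v w (left_wedge x p) = contract_ext v (contract (v x) w) p"
  by (rule linear_eq_on_wedge[where f = "\<lambda>p. contract_ext v w (left_wedge x p)"
        and g = "contract_ext v (contract (v x) w)"])
    (auto intro!: linear_compose[OF linear_left_wedge linear_contract_ext, unfolded o_def]
      simp: assms contract_ext_wedge contract_forms linear_contract_ext)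

lemma fold_contract_diff:
  "fold (\<lambda>x. contract (v x)) xs (u - w) = fold (\<lambda>x. contract (v x)) xs u - fold (\<lambda>x. contract (v x)) xs w"
  by (induction xs arbitrary: u w) simp_all

text \<open>The form is arbitrary in the induction because contraction with the first entry changes
  it. Each exchange of L and a contraction leaves a contraction with a bracket, and these add up to
  ad.\<close>

lemma L_contract_ext:
  "w \<in> forms M \<Longrightarrow> L x (contract_ext v w (wedge xs)) =
    contract_ext v (L x w) (wedge xs) + contract_ext v w (ad_wedge br x xs)"
proof (induction xs arbitrary: w)
  case Nil
  then show ?case
    by (simp add: contract_ext_wedge L_forms_simps linear_0[OF linear_contract_ext])
next
  case (Cons y ys)
  note w = Cons.prems contract_forms[OF Cons.prems] L_forms_simps(1)[OF Cons.prems]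
  have "L x (contract_ext v w (wedge (y # ys))) = L x (contract_ext v (contract (v y) w) (wedge ys))"
    by (simp add: w contract_ext_wedge)
  also have "\<dots> = contract_ext v (L x (contract (v y) w)) (wedge ys)
      + contract_ext v (contract (v y) w) (ad_wedge br x ys)"
    by (rule Cons.IH[OF w(2)])
  also have "L x (contract (v y) w) = contract (v y) (L x w) + contract (v (br x y)) w"
    using contract_lie_deriv[OF v_simps(3) v_simps(3) w(1)] by (simp add: v_simps)
  also have "contract_ext v (contract (v y) (L x w) + contract (v (br x y)) w) (wedge ys) =
      contract_ext v (L x w) (wedge (y # ys)) + contract_ext v w (wedge (br x y # ys))"
    \<comment> \<open>Additivity of the iterated contraction, read off from the rule for differences
      applied to a sum minus its second summand.\<close>
    using fold_contract_diff[of ys "contract (v y) (L x w) + contract (v (br x y)) w" "contract (v (br x y)) w"]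
    by (simp add: w contract_ext_wedge contract_forms forms_add)
  also have "contract_ext v (contract (v y) w) (ad_wedge br x ys) = contract_ext v w (left_wedge y (ad_wedge br x ys))"
    by (simp add: contract_ext_left_wedge w)
  finally show ?case
    by (simp add: linear_add[OF linear_contract_ext[OF w(1)]])
qed

lemma omega_tilde:
  assumes "w \<in> forms M"
  shows linear_omega_tilde: "linear (omega_tilde n w v)"
    and omega_tilde_ext_power: "p \<in> ext_power k \<Longrightarrow> omega_tilde n w v p =
      (if k \<in> {1..n + 1} then (-1) ^ (k - 1) *\<^sub>R contract_ext v w p else 0)"
proof -
  let ?G = "\<lambda>k p. if k \<in> {1..n + 1} then (-1) ^ (k - 1) *\<^sub>R contract_ext v w p else 0"
  have "?G k (p + q) = ?G k p + ?G k q" "?G k (c *\<^sub>R p) = c *\<^sub>R ?G k p" for k p q c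
    by (simp_all add: linear_add[OF linear_contract_ext[OF assms]] linear_scale[OF linear_contract_ext[OF assms]]
        algebra_simps)
  note G = lin_ext_of_linear[where G = ?G, OF this]
  show "linear (omega_tilde n w v)" unfolding omega_tilde_def by (rule G(1))
  show "omega_tilde n w v p = ?G k p" if "p \<in> ext_power k" unfolding omega_tilde_def by (rule G(2)[OF that])
qed

text \<open>ad preserves the degree, so the sign and the range condition in
  \<open>omega_tilde\<close> are the same on both sides.\<close>

lemma L_omega_tilde:
  assumes "w \<in> forms M" "L x w = 0"
  shows "L x (omega_tilde n w v (wedge xs)) = omega_tilde n w v (ad_ext br x (wedge xs))"
proof -
  have "contract_ext v 0 (wedge xs) = 0"
    using fold_contract_diff[of xs 0 0] by (simp add: contract_ext_wedge forms_0)
  then have "L x (contract_ext v w (wedge xs)) = contract_ext v w (ad_ext br x (wedge xs))"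
    using L_contract_ext[OF assms(1), of x xs] by (simp add: assms(2) ad_ext_wedge)
  then show ?thesis
    by (simp add: omega_tilde_ext_power[OF assms(1) wedge_in_ext_power]
        omega_tilde_ext_power[OF assms(1) ad_ext_in_ext_power[OF wedge_in_ext_power]]
        L_forms_simps contract_ext_forms assms(1) lie_deriv_0 v_simps)
qed

end

section \<open>The obstruction class\<close>

context lie_action_mfd
begin

text \<open>The cocycle identity is \<open>act_br\<close>. Since \<alpha> need not be closed, this
  cocycle, although the differential of a constant, need not be a coboundary with values in the
  closed elements.\<close>

lemma CE_diff_const_cocycle:
  assumes \<alpha>: "\<alpha> \<in> C_tilde M" and closed: "\<And>x. act x \<alpha> \<in> closed_elements M br"
  shows "CE_diff br act (CE_const \<alpha>) \<in> CE_cocycles br act (closed_elements M br) 1"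
proof -
  let ?D = "CE_diff br act (CE_const \<alpha>)"
  note lin = linear_CE_diff_const[OF act_0 linear_act[OF \<alpha>]]
  note wedge = CE_diff_const_wedge[OF act_0 linear_act[OF \<alpha>]]
  have other: "?D p = 0" if "j \<noteq> 1" "p \<in> ext_power j" for j p
  proof -
    have "?D p \<in> {0}"
      by (rule linear_image_ext_power[OF lin subspace_single_0 _ that(2)])
        (use that(1) in \<open>auto simp: wedge split: list.split\<close>)
    then show ?thesis by simp
  qed
  have "?D p \<in> closed_elements M br" if "p \<in> ext_power 1" for p
    by (rule linear_image_ext_power[OF lin subspace_closed_elements _ that])
      (auto simp: wedge closed length_Suc_conv)
  then have "?D \<in> CE_cochains (closed_elements M br) 1"
    using lin other by (auto simp: CE_cochains_def)
  moreover have "CE_diff br act ?D = 0"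
    by (rule CE_diff_1_eq_0[where act = act and c = ?D, OF act_0 lin other]) (simp_all add: wedge act_br[OF \<alpha>])
  ultimately show ?thesis by (simp add: CE_cocycles_def)
qed

text \<open>Supplies the closure under subtraction that \<open>CE_class_eq_0_iff\<close> asks
  for.\<close>

lemma CE_diff_const_diff:
  assumes "\<eta> \<in> C_tilde M" "\<theta> \<in> C_tilde M"
  shows "CE_diff br act (CE_const (\<eta> - \<theta>)) = CE_diff br act (CE_const \<eta>) - CE_diff br act (CE_const \<theta>)"
proof (rule eq_minusI)
  fix p
  have lin: "linear (CE_diff br act (CE_const \<xi>))"
    and wedge: "CE_diff br act (CE_const \<xi>) (wedge xs) = (case xs of [x] \<Rightarrow> act x \<xi> | _ \<Rightarrow> 0)"
    if "\<xi> \<in> C_tilde M" for \<xi> xs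
    using CE_diff_const[OF act_0 linear_act[OF that]] by blast+
  note diff = subspace_diff[OF subspace_C_tilde assms]
  show "CE_diff br act (CE_const (\<eta> - \<theta>)) p = CE_diff br act (CE_const \<eta>) p - CE_diff br act (CE_const \<theta>) p"
    by (rule linear_eq_on_wedge[where f = "CE_diff br act (CE_const (\<eta> - \<theta>))"
        and g = "\<lambda>p. CE_diff br act (CE_const \<eta>) p - CE_diff br act (CE_const \<theta>) p"])
      (auto intro!: linear_compose_sub lin diff assms
        simp: wedge diff assms act_linear_simps split: list.split)
qed

text \<open>Cochains of degree 0 are constants, being determined by their value on the empty
  wedge.\<close>

lemma CE_coboundaries_1:
  "CE_coboundaries br act (closed_elements M br) 1 = (\<lambda>\<eta>. CE_diff br act (CE_const \<eta>)) ` closed_elements M br"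
    (is "_ = _ ` ?N")
proof -
  have "(CE_cochains ?N 0 :: ('g ext \<Rightarrow> 'g ext \<Rightarrow> 'm form) set) = CE_const ` ?N"
  proof
    show "(CE_cochains ?N 0 :: ('g ext \<Rightarrow> 'g ext \<Rightarrow> 'm form) set) \<subseteq> CE_const ` ?N"
    proof
      fix c :: "'g ext \<Rightarrow> 'g ext \<Rightarrow> 'm form" assume c: "c \<in> CE_cochains ?N 0"
      have "c (wedge []) \<in> ?N"
        using c wedge_in_ext_power[of "[]"] by (auto simp: CE_cochains_def)
      then show "c \<in> CE_const ` ?N"
        using CE_cochain_0_eq_const[OF c] by blast
    qed
  qed (auto intro: CE_const_cochain[OF subspace_closed_elements])
  then show ?thesis by (simp add: CE_coboundaries_def image_image)
qed

lemma CE_class_const_eq_0_iff: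
  assumes \<alpha>: "\<alpha> \<in> C_tilde M" and closed: "\<And>x. act x \<alpha> \<in> closed_elements M br"
  shows "CE_class br act (closed_elements M br) 1 (CE_diff br act (CE_const \<alpha>)) =
      CE_class br act (closed_elements M br) 1 0 \<longleftrightarrow>
    (\<exists>\<beta>\<in>closed_elements M br. \<forall>x. act x (\<alpha> - \<beta>) = 0)" (is "?class \<longleftrightarrow> _")
proof -
  let ?N = "closed_elements M br" and ?D = "\<lambda>\<eta>. CE_diff br act (CE_const \<eta>)"
  let ?B = "CE_coboundaries br act ?N 1"
  have C: "\<eta> \<in> C_tilde M" if "\<eta> \<in> ?N" for \<eta>
    using that by (simp add: closed_elements_def)
  have zero: "0 \<in> ?N" by (rule subspace_0[OF subspace_closed_elements])
  have D0: "?D 0 = 0"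
    using CE_diff_const_diff[OF C[OF zero] C[OF zero]] by simp
  have "?class \<longleftrightarrow> ?D \<alpha> \<in> ?B"
  proof (rule CE_class_eq_0_iff)
    show "0 \<in> ?B" using zero D0 unfolding CE_coboundaries_1 by (metis image_eqI)
    show "a - b \<in> ?B" if ab: "a \<in> ?B" "b \<in> ?B" for a b
    proof -
      obtain \<eta> \<theta> where "\<eta> \<in> ?N" "\<theta> \<in> ?N" "a = ?D \<eta>" "b = ?D \<theta>"
        using ab unfolding CE_coboundaries_1 by blast
      then have "\<eta> - \<theta> \<in> ?N" "a - b = ?D (\<eta> - \<theta>)"
        by (simp_all add: CE_diff_const_diff C subspace_diff[OF subspace_closed_elements])
      then show ?thesis unfolding CE_coboundaries_1 by blast
    qed
    show "0 \<in> CE_cocycles br act ?N 1"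
      using CE_diff_const_cocycle[OF C[OF zero]] zero by (simp add: act_0 D0)
    show "?D \<alpha> \<in> CE_cocycles br act ?N 1"
      by (rule CE_diff_const_cocycle[OF \<alpha> closed])
  qed
  also have "\<dots> \<longleftrightarrow> (\<exists>\<beta>\<in>?N. ?D \<alpha> = ?D \<beta>)"
    unfolding CE_coboundaries_1 by blast
  also have "\<dots> \<longleftrightarrow> (\<exists>\<beta>\<in>?N. \<forall>x. act x (\<alpha> - \<beta>) = 0)"
  proof (rule bex_cong[OF refl])
    fix \<beta> assume "\<beta> \<in> ?N"
    then have \<beta>: "\<beta> \<in> C_tilde M" by (rule C)
    note lin = linear_CE_diff_const[OF act_0 linear_act[OF \<alpha>]] linear_CE_diff_const[OF act_0 linear_act[OF \<beta>]]
    note wedge = CE_diff_const_wedge[OF act_0 linear_act[OF \<alpha>]] CE_diff_const_wedge[OF act_0 linear_act[OF \<beta>]]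
    \<comment> \<open>Evaluation at a single x gives one direction. For the other, both sides vanish
      on lists of any length but 1, so they agree on all wedges.\<close>
    have "?D \<alpha> = ?D \<beta> \<longleftrightarrow> (\<forall>x. act x \<alpha> = act x \<beta>)"
    proof
      assume eq: "?D \<alpha> = ?D \<beta>"
      show "\<forall>x. act x \<alpha> = act x \<beta>"
      proof
        fix x
        show "act x \<alpha> = act x \<beta>"
          using wedge(1)[of "[x]"] wedge(2)[of "[x]"] by (simp add: eq)
      qed
    next
      assume "\<forall>x. act x \<alpha> = act x \<beta>"
      then have "?D \<alpha> (wedge xs) = ?D \<beta> (wedge xs)" for xs
        by (simp add: wedge split: list.split)
      then show "?D \<alpha> = ?D \<beta>"
        by (rule HOL.ext[OF linear_eq_on_wedge[OF lin]])
    qed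
    then show "?D \<alpha> = ?D \<beta> \<longleftrightarrow> (\<forall>x. act x (\<alpha> - \<beta>) = 0)"
      by (simp add: act_linear_simps(3)[OF \<alpha> \<beta>])
  qed
  finally show ?thesis .
qed

text \<open>An invariant potential need not be homogeneous, so the moment map is built from its component
  of total degree \<open>n\<close>.\<close>

lemma moment_map_of_invariant_potential:
  assumes \<gamma>: "\<gamma> \<in> C_tilde M" and pot: "d_tot M br \<gamma> = omega_tilde n \<omega> v" and inv: "\<And>x. act x \<gamma> = 0"
    and \<omega>: "\<omega> \<in> forms_deg M (n + 1)"
  defines "f \<equiv> \<lambda>k p. zeta k *\<^sub>R form_part (n - k) (\<gamma> p)"
  shows "homotopy_moment_map M n \<omega> br v f" "equivariant_moment_map M n br v f"
proof -
  have \<omega>': "\<omega> \<in> forms M" using \<omega> by (simp add: forms_deg_def)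
  note lin = linear_add[OF C_tildeD(1)[OF \<gamma>]] linear_scale[OF C_tildeD(1)[OF \<gamma>]] linear_0[OF C_tildeD(1)[OF \<gamma>]]
  note forms = C_tildeD(2)[OF \<gamma>]
  have part_forms: "form_part m (\<gamma> p) \<in> forms M" for m p
    using form_part_forms_deg[OF forms] by (simp add: forms_deg_def)
  \<comment> \<open>The continuation by 0 makes k = 1 and k = n + 1 boundary cases that are argued
    separately.\<close>
  define f' where "f' = (\<lambda>k. if k \<in> {1..n} then f k else 0)"
  have eq: "- f' (k - 1) (delta br p) = ext_deriv M (f' k p) + zeta k *\<^sub>R contract_ext v \<omega> p"
    if k: "k \<in> {1..n + 1}" and p: "p \<in> ext_power k" for k p
  proof -
    obtain j where j: "k = Suc j" using k by (cases k) auto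
    \<comment> \<open>The form degree of the k-th equation: contracting \<omega> with k fields
      leaves it, and d raises n - k to it.\<close>
    let ?m = "n + 1 - k"
    let ?A = "form_part ?m (\<gamma> (delta br p))" and ?B = "form_part ?m (ext_deriv M (\<gamma> p))"
      and ?C = "contract_ext v \<omega> p"
    have "\<gamma> (delta br p) + (-1) ^ k *\<^sub>R ext_deriv M (\<gamma> p) = (-1) ^ j *\<^sub>R ?C"
      using d_tot_ext_power[OF \<gamma> p] omega_tilde_ext_power[OF \<omega>' p, of n] k j by (simp add: pot)
    then have "form_part ?m (\<gamma> (delta br p) + (-1) ^ k *\<^sub>R ext_deriv M (\<gamma> p)) = form_part ?m ((-1) ^ j *\<^sub>R ?C)"
      by (rule arg_cong)
    then have "?A + (-1) ^ k *\<^sub>R ?B = (-1) ^ j *\<^sub>R ?C"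
      using form_part_contract_ext[OF \<omega> p] k by (simp only: form_part_linear_simps) simp
    \<comment> \<open>The signs \<open>(-1) ^ k\<close> and \<open>(-1) ^ j\<close> are opposite, so
      solving for the boundary term gives ?B and ?C a common factor.\<close>
    then have A: "?A = (-1) ^ j *\<^sub>R (?C + ?B)"
      by (simp add: j scaleR_add_right diff_eq_eq)
    have "ext_deriv M (f' k p) = zeta k *\<^sub>R ?B"
    proof (cases "k \<le> n")
      case True
      then have "Suc (n - k) = ?m" by simp
      then show ?thesis
        using True k by (simp add: f'_def f_def ext_deriv_scale part_forms ext_deriv_form_part[OF forms])
    next
      \<comment> \<open>Here k = n + 1: the moment map has stopped, and the component of degree 0 of
        an exterior derivative is 0.\<close>
      case False
      moreover have "form_part 0 (ext_deriv M (\<gamma> p)) = 0"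
        by (rule HOL.ext) (simp add: form_part_def ext_deriv_Nil zero_fun_apply)
      ultimately show ?thesis
        using k by (simp add: f'_def zero_fun_apply ext_deriv_0)
    qed
    moreover have "f' (k - 1) (delta br p) = zeta j *\<^sub>R ?A"
    proof (cases "j = 0")
      \<comment> \<open>For k = 1 the boundary is 0, so setting the map of degree 0 to 0 changes
        nothing.\<close>
      case True
      then show ?thesis
        using delta_ext_power_1[OF p] by (simp add: f'_def j lin form_part_linear_simps zero_fun_apply)
    next
      case False
      then show ?thesis using k by (simp add: f'_def f_def j)
    qed
    then have "f' (k - 1) (delta br p) = zeta j *\<^sub>R (-1) ^ j *\<^sub>R (?C + ?B)"
      by (simp only: A)
    \<comment> \<open>The remaining factor \<open>- zeta j * (-1) ^ j\<close> is
      \<open>zeta k\<close> by \<open>zeta_Suc\<close>.\<close>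
    ultimately show ?thesis
      by (simp add: zeta_Suc j scaleR_add_right mult.commute)
  qed
  have "f k p \<in> forms_deg M (n - k)" for k p
    using form_part_forms_deg[OF forms, of "n - k" p]
    by (simp add: f_def forms_deg_def forms_scale form_apply_simps(4))
  moreover have "f k (p + q) = f k p + f k q" "f k (c *\<^sub>R p) = c *\<^sub>R f k p" for k p q c
    by (simp_all add: f_def lin form_part_linear_simps scaleR_add_right)
  ultimately show "homotopy_moment_map M n \<omega> br v f"
    using eq unfolding homotopy_moment_map_def Let_def f'_def by blast
  have "L x (\<gamma> p) = \<gamma> (ad_ext br x p)" for x p
    using fun_cong[OF inv[of x], of p] by (simp add: C_act_def zero_fun_apply)
  then show "equivariant_moment_map M n br v f"
    by (simp add: equivariant_moment_map_def f_def L_forms_simps(2)[OF part_forms] lie_deriv_form_part v_simps)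
qed

text \<open>Because \<open>zeta k\<close> is 1 or -1, multiplying by it is its own inverse. The
  potential is the moment map rescaled degree by degree and continued by 0; equivariance is a
  condition in each degree and survives.\<close>

lemma invariant_potential_of_moment_map:
  assumes mm: "homotopy_moment_map M n \<omega> br v f" and equiv: "equivariant_moment_map M n br v f"
    and \<omega>: "\<omega> \<in> forms M"
  obtains \<gamma> where "\<gamma> \<in> C_tilde M" "d_tot M br \<gamma> = omega_tilde n \<omega> v" "\<And>x. act x \<gamma> = 0"
proof -
  define f' where "f' = (\<lambda>k. if k \<in> {1..n} then f k else 0)"
  have eq: "- f' (k - 1) (delta br p) = ext_deriv M (f' k p) + zeta k *\<^sub>R contract_ext v \<omega> p"
    if "k \<in> {1..n + 1}" "p \<in> ext_power k" for k p
    using mm that unfolding homotopy_moment_map_def Let_def f'_def by blast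
  have forms: "f' k p \<in> forms M" and add: "f' k (p + q) = f' k p + f' k q"
    and scale: "f' k (c *\<^sub>R p) = c *\<^sub>R f' k p"
    if "p \<in> ext_power k" "q \<in> ext_power k" for k p q c
    using mm that
    by (auto simp: homotopy_moment_map_def f'_def forms_deg_def forms_0 zero_fun_apply image_subset_iff)
  have outside: "f' k p = 0" if "k \<notin> {1..n}" for k p
    unfolding f'_def using that by (simp only: if_False zero_fun_apply)
  let ?G = "\<lambda>k p. zeta k *\<^sub>R f' k p"
  define \<gamma> where "\<gamma> = lin_ext (\<lambda>xs. ?G (length xs) (wedge xs))"
  have lin: "linear \<gamma>" and \<gamma>: "\<And>p k. p \<in> ext_power k \<Longrightarrow> \<gamma> p = ?G k p"
    unfolding \<gamma>_def
    by (rule lin_ext_of_linear[where G = ?G]; simp add: add scale scaleR_add_right)+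
  have "\<gamma> p \<in> forms M" for p
  proof -
    have "\<gamma> p \<in> span (\<gamma> ` range wedge)"
      using ext_in_span_wedge[of p] by (simp add: linear_span_image[OF lin])
    moreover have "\<gamma> ` range wedge \<subseteq> forms M"
      using forms[OF wedge_in_ext_power wedge_in_ext_power] by (auto simp: \<gamma>[OF wedge_in_ext_power] forms_scale)
    ultimately show ?thesis using span_minimal[OF _ subspace_forms] by blast
  qed
  then have C: "\<gamma> \<in> C_tilde M"
    using lin \<gamma>[where k = 0] by (auto simp: C_tilde_def outside)
  have "d_tot M br \<gamma> (wedge xs) = omega_tilde n \<omega> v (wedge xs)" for xs
  proof -
    let ?k = "length xs" and ?p = "wedge xs"
    note p = wedge_in_ext_power[of xs]
    have d: "d_tot M br \<gamma> ?p = ?G (?k - 1) (delta br ?p) + (-1) ^ ?k *\<^sub>R ext_deriv M (?G ?k ?p)"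
      by (simp add: d_tot_ext_power[OF C p] \<gamma>[OF p] \<gamma>[OF delta_in_ext_power[OF p]])
    show ?thesis
    proof (cases "?k \<in> {1..n + 1}")
      case True
      then obtain j where j: "?k = Suc j" by (cases ?k) auto
      have "f' j (delta br ?p) = - (ext_deriv M (f' ?k ?p) + zeta ?k *\<^sub>R contract_ext v \<omega> ?p)"
        using arg_cong[OF eq[OF True p], of uminus] j by simp
      then have "d_tot M br \<gamma> ?p = - zeta j *\<^sub>R (ext_deriv M (f' ?k ?p) + zeta ?k *\<^sub>R contract_ext v \<omega> ?p)
          + ((-1) ^ ?k * zeta ?k) *\<^sub>R ext_deriv M (f' ?k ?p)"
        by (simp add: d j ext_deriv_scale[OF forms[OF p p], unfolded j] scaleR_diff_right scaleR_add_right del: power_Suc)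
      also have "(-1) ^ ?k * zeta ?k = zeta j"
        by (simp add: j zeta_Suc)
      also have "- zeta j *\<^sub>R (ext_deriv M (f' ?k ?p) + zeta ?k *\<^sub>R contract_ext v \<omega> ?p)
          + zeta j *\<^sub>R ext_deriv M (f' ?k ?p) = - (zeta j * zeta ?k) *\<^sub>R contract_ext v \<omega> ?p"
        by (simp add: scaleR_add_right)
      \<comment> \<open>This is the sign with which \<open>omega_tilde\<close> carries the
        contraction in degree j + 1.\<close>
      also have "- (zeta j * zeta ?k) = (-1) ^ j"
        using zeta_square[of j] by (simp add: j zeta_Suc mult.left_commute)
      also have "(-1) ^ j *\<^sub>R contract_ext v \<omega> ?p = omega_tilde n \<omega> v ?p"
        using True j by (simp add: omega_tilde_ext_power[OF \<omega> p])
      finally show ?thesis .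
    next
      \<comment> \<open>The length is 0 or exceeds n + 1. In both cases it and its predecessor (0
        for length 0) lie outside \<open>{1..n}\<close>, so every term is 0.\<close>
      case False
      have "f' (?k - 1) (delta br ?p) = 0"
        using False by (intro outside) auto
      moreover have "f' ?k ?p = 0" using False by (intro outside) auto
      moreover have "omega_tilde n \<omega> v ?p = 0"
        using False by (simp only: omega_tilde_ext_power[OF \<omega> p] if_False)
      ultimately show ?thesis by (simp add: d ext_deriv_0)
    qed
  qed
  then have d: "d_tot M br \<gamma> = omega_tilde n \<omega> v"
    by (rule HOL.ext[OF linear_eq_on_wedge[OF linear_d_tot[OF C] linear_omega_tilde[OF \<omega>]]])
  have "act x \<gamma> = 0" for x
  proof
    fix p
    have "act x \<gamma> (wedge xs) = 0" for xs
    proof -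
      have "f' (length xs) (ad_ext br x (wedge xs)) = L x (f' (length xs) (wedge xs))"
        using equiv wedge_in_ext_power[of xs]
        by (auto simp: equivariant_moment_map_def f'_def zero_fun_apply lie_deriv_0 v_simps)
      then show ?thesis
        by (simp add: C_act_def \<gamma>[OF wedge_in_ext_power] \<gamma>[OF ad_ext_in_ext_power[OF wedge_in_ext_power]]
            L_forms_simps(2)[OF forms[OF wedge_in_ext_power wedge_in_ext_power]])
    qed
    then have "act x \<gamma> p = (\<lambda>_. 0) p"
      by (rule linear_eq_on_wedge[OF C_tildeD(1)[OF act_C_tilde[OF C]] linear_zero])
    then show "act x \<gamma> p = 0 p" by (simp only: zero_fun_apply)
  qed
  with C d show thesis by (rule that)
qed

end

theorem proposition3p7:
  fixes M :: "'m::{t2_space, second_countable_topology} manifold"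
    and n :: nat
    and \<omega> :: "'m form"
    and br :: "'g::real_vector \<Rightarrow> 'g \<Rightarrow> 'g"
    and v :: "'g \<Rightarrow> 'm vf"
    and \<alpha> :: "'g ext \<Rightarrow> 'm form"
    and f :: "nat \<Rightarrow> 'g ext \<Rightarrow> 'm form"
  assumes "smooth_manifold M"
    and "n_plectic M n \<omega>"
    and "lie_algebra br"
    and "\<exists>B. finite B \<and> span B = (UNIV :: 'g set)"
    and "lie_action M br v"
    and "preserves_form M v \<omega>"
    and "\<alpha> \<in> C_tilde_deg M n"
    and "d_tot M br \<alpha> = omega_tilde n \<omega> v"
    and "homotopy_moment_map M n \<omega> br v f"
    and "\<forall>k\<in>{1..n}. \<forall>p\<in>ext_power k. f k p = zeta k *\<^sub>R \<alpha> p"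
  shows "let act = C_act M br v;
             N = closed_elements M br;
             D = CE_diff br act (CE_const \<alpha>)
         in lie_module br act N \<and>
            (\<forall>x. D (wedge [x]) = act x \<alpha>) \<and>
            (\<forall>x. act x \<alpha> \<in> N) \<and>
            D \<in> CE_cocycles br act N 1 \<and>
            CE_class br act N 1 D \<in> CE_cohomology br act N 1 \<and>
            (CE_class br act N 1 D = CE_class br act N 1 0 \<longleftrightarrow>
             (\<exists>f'. homotopy_moment_map M n \<omega> br v f' \<and> equivariant_moment_map M n br v f'))"
proof -
  interpret lie_action_mfd M br v
    using assms by unfold_locales
  have \<omega>: "\<omega> \<in> forms_deg M (n + 1)" "\<omega> \<in> forms M"
    using assms(2) by (auto simp: n_plectic_def forms_deg_def)
  have \<alpha>: "\<alpha> \<in> C_tilde M"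
    using assms(7) by (simp add: C_tilde_deg_def)
  have "L x \<omega> = 0" for x
    using assms(6) by (simp add: preserves_form_def)
  then have "d_tot M br (act x \<alpha>) = 0" for x
    by (intro d_tot_act_eq_0[OF \<alpha>]) (simp add: assms(8) L_omega_tilde[OF \<omega>(2)])
  then have closed: "act x \<alpha> \<in> closed_elements M br" for x
    by (simp add: closed_elements_def act_C_tilde[OF \<alpha>])
  let ?D = "CE_diff br act (CE_const \<alpha>)"
  have cocycle: "?D \<in> CE_cocycles br act (closed_elements M br) 1"
    by (rule CE_diff_const_cocycle[OF \<alpha> closed])
  have "?D (wedge [x]) = act x \<alpha>" for x
    using CE_diff_const_wedge[OF act_0 linear_act[OF \<alpha>], of "[x]"] by simp
  moreover have "CE_class br act (closed_elements M br) 1 ?D \<in> CE_cohomology br act (closed_elements M br) 1"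
    unfolding CE_cohomology_def CE_class_def by (rule quotientI[OF cocycle])
  moreover have "(\<exists>\<beta>\<in>closed_elements M br. \<forall>x. act x (\<alpha> - \<beta>) = 0) \<longleftrightarrow>
      (\<exists>f'. homotopy_moment_map M n \<omega> br v f' \<and> equivariant_moment_map M n br v f')"
  proof
    assume "\<exists>\<beta>\<in>closed_elements M br. \<forall>x. act x (\<alpha> - \<beta>) = 0"
    then obtain \<beta> where \<beta>: "\<beta> \<in> C_tilde M" "d_tot M br \<beta> = 0" "\<And>x. act x (\<alpha> - \<beta>) = 0"
      by (auto simp: closed_elements_def)
    have "d_tot M br (\<alpha> - \<beta>) = omega_tilde n \<omega> v"
      by (simp add: d_tot_diff \<alpha> \<beta> assms(8))
    from moment_map_of_invariant_potential[OF subspace_diff[OF subspace_C_tilde \<alpha> \<beta>(1)] this \<beta>(3) \<omega>(1)]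
    show "\<exists>f'. homotopy_moment_map M n \<omega> br v f' \<and> equivariant_moment_map M n br v f'"
      by blast
  next
    assume "\<exists>f'. homotopy_moment_map M n \<omega> br v f' \<and> equivariant_moment_map M n br v f'"
    then obtain \<gamma> where \<gamma>: "\<gamma> \<in> C_tilde M" "d_tot M br \<gamma> = omega_tilde n \<omega> v" "\<And>x. act x \<gamma> = 0"
      using invariant_potential_of_moment_map[OF _ _ \<omega>(2)] by metis
    \<comment> \<open>Two potentials of the same element differ by a closed one; subtracting this
      difference from \<alpha> returns the invariant \<gamma>.\<close>
    have "\<alpha> - \<gamma> \<in> closed_elements M br"
      by (simp add: closed_elements_def subspace_diff[OF subspace_C_tilde] d_tot_diff \<alpha> \<gamma> assms(8))
    then show "\<exists>\<beta>\<in>closed_elements M br. \<forall>x. act x (\<alpha> - \<beta>) = 0"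
      using \<gamma>(3) by (intro bexI[of _ "\<alpha> - \<gamma>"]) simp_all
  qed
  ultimately show ?thesis
    using lie_module_closed_elements closed cocycle
    by (simp add: Let_def CE_class_const_eq_0_iff[OF \<alpha> closed, unfolded One_nat_def])
qed

end
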